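(* Let $E$ and $F$ be graphs. If $\phi : L_{\mathbb{C}}(E) \to L_{\mathbb{C}}(F)$ is an algebra $*$-homomorphism, then there exists a unique algebra $*$-homomorphism $\overline{\phi} : C^*(E) \to C^*(F)$ such that $\overline{\phi} \circ \iota_E = \iota_F \circ \phi$. Moreover, if $\phi : L_{\mathbb{C}}(E) \to L_{\mathbb{C}}(F)$ is an algebra $*$-isomorphism, then $\overline{\phi} : C^*(E) \to C^*(F)$ is an algebra $*$-isomorphism.
   Context: A graph $E=(E^0,E^1,r,s)$ consists of a countable set $E^0$ of vertices, a countable set $E^1$ of edges, and maps $r,s:E^1\to E^0$ (range and source). A vertex $v$ is regular if $0<|s^{-1}(v)|<\infty$. $C^*(E)$ is the universal $C^*$-algebra generated by mutually orthogonal projections $\{p_v:v\in E^0\}$ and partial isometries $\{s_e:e\in E^1\}$ with mutually orthogonal ranges ($s_e^*s_f=0$ for $e\ne f$) satisfying $s_e^*s_e=p_{r(e)}$ and $s_es_e^*\le p_{s(e)}$ for all $e\in E^1$, and $p_v=\sum_{s(e)=v}s_es_e^*$ for every regular vertex $v$. $L_{\mathbb{C}}(E)$ (the Leavitt path algebra) is the (not necessarily unital) associative $\mathbb{C}$-algebra generated by pairwise orthogonal idempotents $\{v:v\in E^0\}$ and elements $\{e,e^*:e\in E^1\}$ subject to $s(e)e=er(e)=e$, $r(e)e^*=e^*s(e)=e^*$, $e^*f=\delta_{e,f}\,r(e)$ for $e,f\in E^1$, and $v=\sum_{s(e)=v}ee^*$ for every regular vertex $v$. It is a $*$-algebra under the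 conjugate-linear, product-reversing involution with $v^*=v$ and $e\mapsto e^*$. $\iota_E:L_{\mathbb{C}}(E)\to C^*(E)$ is the canonical injective algebra $*$-homomorphism with $\iota_E(v)=p_v$ and $\iota_E(e)=s_e$; similarly for $\iota_F$. An algebra $*$-homomorphism is a $\mathbb{C}$-linear, multiplicative, $*$-preserving map (not required to preserve identity elements). *)

theory Defs
  imports
    "HOL-Algebra.Module"
    "HOL-Library.Poly_Mapping"
    "HOL-Library.Countable_Set"
    "Graph_Theory.Digraph"
begin

section \<open>Complex *-algebras and C*-algebras with explicit carriers\<close>

text \<open>
  Algebras are not assumed to be unital: the field \<open>one\<close>, inherited from the ring records of
  HOL-Algebra, is ignored throughout.
\<close>

record 'a star_alg = "(complex, 'a) module" +
  adj :: "'a \<Rightarrow> 'a"  ("_\<^sup>\<star>\<index>" [1000] 999)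

record 'a normed_star_alg = "'a star_alg" +
  nrm :: "'a \<Rightarrow> real"

locale star_algebra = abelian_group A for A :: "('a, 'm) star_alg_scheme" (structure) +
  assumes smult_closed: "x \<in> carrier A \<Longrightarrow> c \<odot> x \<in> carrier A"
    and smult_l_distr: "x \<in> carrier A \<Longrightarrow> (c + d) \<odot> x = c \<odot> x \<oplus> d \<odot> x"
    and smult_r_distr: "x \<in> carrier A \<Longrightarrow> y \<in> carrier A \<Longrightarrow> c \<odot> (x \<oplus> y) = c \<odot> x \<oplus> c \<odot> y"
    and smult_assoc: "x \<in> carrier A \<Longrightarrow> (c * d) \<odot> x = c \<odot> (d \<odot> x)"
    and smult_one: "x \<in> carrier A \<Longrightarrow> 1 \<odot> x = x"
    and mult_closed: "x \<in> carrier A \<Longrightarrow> y \<in> carrier A \<Longrightarrow> x \<otimes> y \<in> carrier A"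
    and mult_assoc: "x \<in> carrier A \<Longrightarrow> y \<in> carrier A \<Longrightarrow> z \<in> carrier A \<Longrightarrow>
      (x \<otimes> y) \<otimes> z = x \<otimes> (y \<otimes> z)"
    and mult_l_distr: "x \<in> carrier A \<Longrightarrow> y \<in> carrier A \<Longrightarrow> z \<in> carrier A \<Longrightarrow>
      (x \<oplus> y) \<otimes> z = x \<otimes> z \<oplus> y \<otimes> z"
    and mult_r_distr: "x \<in> carrier A \<Longrightarrow> y \<in> carrier A \<Longrightarrow> z \<in> carrier A \<Longrightarrow>
      z \<otimes> (x \<oplus> y) = z \<otimes> x \<oplus> z \<otimes> y"
    and smult_mult_l: "x \<in> carrier A \<Longrightarrow> y \<in> carrier A \<Longrightarrow> (c \<odot> x) \<otimes> y = c \<odot> (x \<otimes> y)"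
    and smult_mult_r: "x \<in> carrier A \<Longrightarrow> y \<in> carrier A \<Longrightarrow> x \<otimes> (c \<odot> y) = c \<odot> (x \<otimes> y)"
    and adj_closed: "x \<in> carrier A \<Longrightarrow> x\<^sup>\<star> \<in> carrier A"
    and adj_adj: "x \<in> carrier A \<Longrightarrow> (x\<^sup>\<star>)\<^sup>\<star> = x"
    and adj_add: "x \<in> carrier A \<Longrightarrow> y \<in> carrier A \<Longrightarrow> (x \<oplus> y)\<^sup>\<star> = x\<^sup>\<star> \<oplus> y\<^sup>\<star>"
    and adj_smult: "x \<in> carrier A \<Longrightarrow> (c \<odot> x)\<^sup>\<star> = cnj c \<odot> x\<^sup>\<star>"
    and adj_mult: "x \<in> carrier A \<Longrightarrow> y \<in> carrier A \<Longrightarrow> (x \<otimes> y)\<^sup>\<star> = y\<^sup>\<star> \<otimes> x\<^sup>\<star>"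

locale cstar_algebra = star_algebra A for A :: "('a, 'm) normed_star_alg_scheme" (structure) +
  assumes nrm_eq_0: "x \<in> carrier A \<Longrightarrow> nrm A x = 0 \<longleftrightarrow> x = \<zero>"
    and nrm_triangle: "x \<in> carrier A \<Longrightarrow> y \<in> carrier A \<Longrightarrow> nrm A (x \<oplus> y) \<le> nrm A x + nrm A y"
    and nrm_smult: "x \<in> carrier A \<Longrightarrow> nrm A (c \<odot> x) = cmod c * nrm A x"
    and nrm_mult: "x \<in> carrier A \<Longrightarrow> y \<in> carrier A \<Longrightarrow> nrm A (x \<otimes> y) \<le> nrm A x * nrm A y"
    and nrm_cstar: "x \<in> carrier A \<Longrightarrow> nrm A (x\<^sup>\<star> \<otimes> x) = (nrm A x)\<^sup>2"
    and complete: "(\<And>n. X n \<in> carrier A) \<Longrightarrow>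
      (\<And>e. e > 0 \<Longrightarrow> \<exists>N. \<forall>m\<ge>N. \<forall>n\<ge>N. nrm A (X m \<ominus> X n) < e) \<Longrightarrow>
      \<exists>x\<in>carrier A. (\<lambda>n. nrm A (X n \<ominus> x)) \<longlonglongrightarrow> 0"

text \<open>
  A map between carriers is represented by its extensional (\<open>undefined\<close> off the carrier) HOL
  function, so that equality of homomorphisms is equality on the carrier.
\<close>

definition star_hom ::
  "('a, 'm) star_alg_scheme \<Rightarrow> ('b, 'n) star_alg_scheme \<Rightarrow> ('a \<Rightarrow> 'b) set" where
  "star_hom A B = {f \<in> carrier A \<rightarrow>\<^sub>E carrier B.
     (\<forall>x\<in>carrier A. \<forall>y\<in>carrier A. f (x \<oplus>\<^bsub>A\<^esub> y) = f x \<oplus>\<^bsub>B\<^esub> f y) \<and>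
     (\<forall>c. \<forall>x\<in>carrier A. f (c \<odot>\<^bsub>A\<^esub> x) = c \<odot>\<^bsub>B\<^esub> f x) \<and>
     (\<forall>x\<in>carrier A. \<forall>y\<in>carrier A. f (x \<otimes>\<^bsub>A\<^esub> y) = f x \<otimes>\<^bsub>B\<^esub> f y) \<and>
     (\<forall>x\<in>carrier A. f (x\<^sup>\<star>\<^bsub>A\<^esub>) = (f x)\<^sup>\<star>\<^bsub>B\<^esub>)}"

definition star_iso ::
  "('a, 'm) star_alg_scheme \<Rightarrow> ('b, 'n) star_alg_scheme \<Rightarrow> ('a \<Rightarrow> 'b) set" where
  "star_iso A B = {f \<in> star_hom A B. bij_betw f (carrier A) (carrier B)}"


section \<open>Quotients by two-sided ideals\<close>

definition coset :: "('a, 'm) star_alg_scheme \<Rightarrow> 'a set \<Rightarrow> 'a \<Rightarrow> 'a set" where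
  "coset A I x = (\<lambda>i. x \<oplus>\<^bsub>A\<^esub> i) ` I"

text \<open>
  Each operation is applied to all representatives; for a two-sided ideal \<open>I\<close> closed under
  adjoints, the cosets united on each right-hand side all coincide.
\<close>

definition quotient_algebra :: "('a, 'm) star_alg_scheme \<Rightarrow> 'a set \<Rightarrow> 'a set star_alg" where
  "quotient_algebra A I = \<lparr>
     carrier = coset A I ` carrier A,
     mult = (\<lambda>X Y. \<Union>x\<in>X. \<Union>y\<in>Y. coset A I (x \<otimes>\<^bsub>A\<^esub> y)),
     one = undefined,
     zero = coset A I \<zero>\<^bsub>A\<^esub>,
     add = (\<lambda>X Y. \<Union>x\<in>X. \<Union>y\<in>Y. coset A I (x \<oplus>\<^bsub>A\<^esub> y)),
     smult = (\<lambda>c X. \<Union>x\<in>X. coset A I (c \<odot>\<^bsub>A\<^esub> x)),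
     adj = (\<lambda>X. \<Union>x\<in>X. coset A I (x\<^sup>\<star>\<^bsub>A\<^esub>))\<rparr>"

inductive_set ideal_gen :: "('a, 'm) star_alg_scheme \<Rightarrow> 'a set \<Rightarrow> 'a set"
  for A :: "('a, 'm) star_alg_scheme" (structure) and R :: "'a set" where
  gen: "x \<in> R \<Longrightarrow> x \<in> ideal_gen A R"
| zero: "\<zero> \<in> ideal_gen A R"
| add: "x \<in> ideal_gen A R \<Longrightarrow> y \<in> ideal_gen A R \<Longrightarrow> x \<oplus> y \<in> ideal_gen A R"
| smult: "x \<in> ideal_gen A R \<Longrightarrow> c \<odot> x \<in> ideal_gen A R"
| l_mult: "a \<in> carrier A \<Longrightarrow> x \<in> ideal_gen A R \<Longrightarrow> a \<otimes> x \<in> ideal_gen A R"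
| r_mult: "a \<in> carrier A \<Longrightarrow> x \<in> ideal_gen A R \<Longrightarrow> x \<otimes> a \<in> ideal_gen A R"


section \<open>Universal C*-algebras\<close>

definition cstar_seminorm :: "('a, 'm) star_alg_scheme \<Rightarrow> ('a \<Rightarrow> real) \<Rightarrow> bool" where
  "cstar_seminorm A q \<longleftrightarrow>
     (\<forall>x\<in>carrier A. \<forall>y\<in>carrier A. q (x \<oplus>\<^bsub>A\<^esub> y) \<le> q x + q y) \<and>
     (\<forall>c. \<forall>x\<in>carrier A. q (c \<odot>\<^bsub>A\<^esub> x) = cmod c * q x) \<and>
     (\<forall>x\<in>carrier A. \<forall>y\<in>carrier A. q (x \<otimes>\<^bsub>A\<^esub> y) \<le> q x * q y) \<and>
     (\<forall>x\<in>carrier A. q (x\<^sup>\<star>\<^bsub>A\<^esub> \<otimes>\<^bsub>A\<^esub> x) = (q x)\<^sup>2)"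

text \<open>
  The largest C*-seminorm on \<open>A\<close> vanishing on the relators \<open>R\<close>. C*-seminorms on a *-algebra are
  exactly the functions \<open>\<lambda>x. \<parallel>\<pi> x\<parallel>\<close> for *-homomorphisms \<open>\<pi>\<close> to C*-algebras, so this is the
  supremum over all representations of the relations, without quantifying over types. The
  supremum is only meaningful when it is finite.
\<close>

definition universal_seminorm :: "('a, 'm) star_alg_scheme \<Rightarrow> 'a set \<Rightarrow> 'a \<Rightarrow> real" where
  "universal_seminorm A R x = Sup {q x | q. cstar_seminorm A q \<and> (\<forall>r\<in>R. q r = 0)}"

definition cauchy_seqs :: "('a, 'm) star_alg_scheme \<Rightarrow> ('a \<Rightarrow> real) \<Rightarrow> (nat \<Rightarrow> 'a) set" where
  "cauchy_seqs A q = {X. (\<forall>n. X n \<in> carrier A) \<and>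
     (\<forall>e>0. \<exists>N. \<forall>m\<ge>N. \<forall>n\<ge>N. q (X m \<ominus>\<^bsub>A\<^esub> X n) < e)}"

definition null_seqs :: "('a, 'm) star_alg_scheme \<Rightarrow> ('a \<Rightarrow> real) \<Rightarrow> (nat \<Rightarrow> 'a) set" where
  "null_seqs A q = {X. (\<forall>n. X n \<in> carrier A) \<and> (\<lambda>n. q (X n)) \<longlonglongrightarrow> 0}"

definition cauchy_algebra ::
  "('a, 'm) star_alg_scheme \<Rightarrow> ('a \<Rightarrow> real) \<Rightarrow> (nat \<Rightarrow> 'a) star_alg" where
  "cauchy_algebra A q = \<lparr>
     carrier = cauchy_seqs A q,
     mult = (\<lambda>X Y n. X n \<otimes>\<^bsub>A\<^esub> Y n),
     one = undefined,
     zero = (\<lambda>n. \<zero>\<^bsub>A\<^esub>),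
     add = (\<lambda>X Y n. X n \<oplus>\<^bsub>A\<^esub> Y n),
     smult = (\<lambda>c X n. c \<odot>\<^bsub>A\<^esub> X n),
     adj = (\<lambda>X n. (X n)\<^sup>\<star>\<^bsub>A\<^esub>)\<rparr>"

text \<open>The Hausdorff completion of \<open>A\<close> with respect to the C*-seminorm \<open>q\<close>.\<close>

definition completion ::
  "('a, 'm) star_alg_scheme \<Rightarrow> ('a \<Rightarrow> real) \<Rightarrow> (nat \<Rightarrow> 'a) set normed_star_alg" where
  "completion A q = star_alg.extend (quotient_algebra (cauchy_algebra A q) (null_seqs A q))
     \<lparr>nrm = (\<lambda>C. lim (\<lambda>n. q ((SOME X. X \<in> C) n)))\<rparr>"

definition to_completion ::
  "('a, 'm) star_alg_scheme \<Rightarrow> ('a \<Rightarrow> real) \<Rightarrow> 'a \<Rightarrow> (nat \<Rightarrow> 'a) set" where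
  "to_completion A q x = coset (cauchy_algebra A q) (null_seqs A q) (\<lambda>_. x)"


section \<open>The free *-algebra on the vertices and edges of a graph\<close>

datatype ('v, 'e) generator = Vertex 'v | Edge 'e | Ghost 'e

fun generator_adj :: "('v, 'e) generator \<Rightarrow> ('v, 'e) generator" where
  "generator_adj (Vertex v) = Vertex v"
| "generator_adj (Edge e) = Ghost e"
| "generator_adj (Ghost e) = Edge e"

text \<open>
  The free monoid on \<open>'g\<close>, written additively because the convolution product of
  \<^theory>\<open>HOL-Library.Poly_Mapping\<close> is defined for additive exponent monoids.
\<close>

datatype 'g word = Word (letters: "'g list")

instantiation word :: (type) monoid_add
begin

definition zero_word :: "'a word" where
  "0 = Word []"

definition plus_word :: "'a word \<Rightarrow> 'a word \<Rightarrow> 'a word" where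
  "u + w = Word (letters u @ letters w)"

instance
  by standard (simp_all add: zero_word_def plus_word_def)

end

type_synonym ('v, 'e) free_alg = "('v, 'e) generator word \<Rightarrow>\<^sub>0 complex"

definition gen :: "('v, 'e) generator \<Rightarrow> ('v, 'e) free_alg" where
  "gen g = Poly_Mapping.single (Word [g]) 1"

abbreviation vx :: "'v \<Rightarrow> ('v, 'e) free_alg" where
  "vx v \<equiv> gen (Vertex v)"

abbreviation ed :: "'e \<Rightarrow> ('v, 'e) free_alg" where
  "ed e \<equiv> gen (Edge e)"

abbreviation gh :: "'e \<Rightarrow> ('v, 'e) free_alg" where
  "gh e \<equiv> gen (Ghost e)"

definition word_adj :: "('v, 'e) generator word \<Rightarrow> ('v, 'e) generator word" where
  "word_adj w = Word (rev (map generator_adj (letters w)))"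

definition free_adj :: "('v, 'e) free_alg \<Rightarrow> ('v, 'e) free_alg" where
  "free_adj x = Poly_Mapping.map cnj (Poly_Mapping.map_key word_adj x)"

text \<open>The empty word is excluded, so the free algebra is the non-unital one.\<close>

definition free_star_algebra ::
  "('v, 'e) generator set \<Rightarrow> ('v, 'e) free_alg star_alg" where
  "free_star_algebra G = \<lparr>
     carrier = {x. \<forall>w\<in>Poly_Mapping.keys x. letters w \<noteq> [] \<and> set (letters w) \<subseteq> G},
     mult = (*),
     one = undefined,
     zero = 0,
     add = (+),
     smult = (\<lambda>c. Poly_Mapping.map ((*) c)),
     adj = free_adj\<rparr>"


section \<open>Leavitt path algebras and graph C*-algebras\<close>

text \<open>The source and range maps of a graph are the fields \<open>tail\<close> and \<open>head\<close>.\<close>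

locale countable_graph = wf_digraph E for E :: "('v, 'e) pre_digraph" +
  assumes countable_verts: "countable (verts E)"
    and countable_arcs: "countable (arcs E)"

definition regular_vertex :: "('v, 'e) pre_digraph \<Rightarrow> 'v \<Rightarrow> bool" where
  "regular_vertex E v \<longleftrightarrow> v \<in> verts E \<and> out_arcs E v \<noteq> {} \<and> finite (out_arcs E v)"

definition generators :: "('v, 'e) pre_digraph \<Rightarrow> ('v, 'e) generator set" where
  "generators E = Vertex ` verts E \<union> Edge ` arcs E \<union> Ghost ` arcs E"

inductive_set leavitt_relators :: "('v, 'e) pre_digraph \<Rightarrow> ('v, 'e) free_alg set"
  for E :: "('v, 'e) pre_digraph" where
  idempotent: "v \<in> verts E \<Longrightarrow> vx v * vx v - vx v \<in> leavitt_relators E"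
| orthogonal: "v \<in> verts E \<Longrightarrow> w \<in> verts E \<Longrightarrow> v \<noteq> w \<Longrightarrow> vx v * vx w \<in> leavitt_relators E"
| source_edge: "e \<in> arcs E \<Longrightarrow> vx (tail E e) * ed e - ed e \<in> leavitt_relators E"
| edge_range: "e \<in> arcs E \<Longrightarrow> ed e * vx (head E e) - ed e \<in> leavitt_relators E"
| range_ghost: "e \<in> arcs E \<Longrightarrow> vx (head E e) * gh e - gh e \<in> leavitt_relators E"
| ghost_source: "e \<in> arcs E \<Longrightarrow> gh e * vx (tail E e) - gh e \<in> leavitt_relators E"
| CK1: "e \<in> arcs E \<Longrightarrow> f \<in> arcs E \<Longrightarrow>
    gh e * ed f - (if e = f then vx (head E e) else 0) \<in> leavitt_relators E"
| CK2: "regular_vertex E v \<Longrightarrow>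
    vx v - (\<Sum>e\<in>out_arcs E v. ed e * gh e) \<in> leavitt_relators E"

definition leavitt_path_algebra ::
  "('v, 'e) pre_digraph \<Rightarrow> ('v, 'e) free_alg set star_alg" where
  "leavitt_path_algebra E =
     quotient_algebra (free_star_algebra (generators E))
       (ideal_gen (free_star_algebra (generators E)) (leavitt_relators E))"

text \<open>
  Here \<open>vx v\<close>, \<open>ed e\<close> and \<open>gh e\<close> stand for the projection at \<open>v\<close>, the partial isometry of \<open>e\<close> and
  its adjoint; self-adjointness of the projections is built into \<^const>\<open>generator_adj\<close>. In
  \<open>range_le\<close>, the order on projections is rendered as usual: \<open>q \<le> p\<close> means \<open>p q = q\<close>.
\<close>

inductive_set cuntz_krieger_relators :: "('v, 'e) pre_digraph \<Rightarrow> ('v, 'e) free_alg set"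
  for E :: "('v, 'e) pre_digraph" where
  projection: "v \<in> verts E \<Longrightarrow> vx v * vx v - vx v \<in> cuntz_krieger_relators E"
| orthogonal: "v \<in> verts E \<Longrightarrow> w \<in> verts E \<Longrightarrow> v \<noteq> w \<Longrightarrow> vx v * vx w \<in> cuntz_krieger_relators E"
| partial_isometry: "e \<in> arcs E \<Longrightarrow> ed e * gh e * ed e - ed e \<in> cuntz_krieger_relators E"
| orthogonal_ranges: "e \<in> arcs E \<Longrightarrow> f \<in> arcs E \<Longrightarrow> e \<noteq> f \<Longrightarrow>
    gh e * ed f \<in> cuntz_krieger_relators E"
| initial_projection: "e \<in> arcs E \<Longrightarrow> gh e * ed e - vx (head E e) \<in> cuntz_krieger_relators E"
| range_le: "e \<in> arcs E \<Longrightarrow>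
    vx (tail E e) * (ed e * gh e) - ed e * gh e \<in> cuntz_krieger_relators E"
| range_sum: "regular_vertex E v \<Longrightarrow>
    vx v - (\<Sum>e\<in>out_arcs E v. ed e * gh e) \<in> cuntz_krieger_relators E"

definition cuntz_krieger_seminorm :: "('v, 'e) pre_digraph \<Rightarrow> ('v, 'e) free_alg \<Rightarrow> real" where
  "cuntz_krieger_seminorm E =
     universal_seminorm (free_star_algebra (generators E)) (cuntz_krieger_relators E)"

definition graph_cstar ::
  "('v, 'e) pre_digraph \<Rightarrow> (nat \<Rightarrow> ('v, 'e) free_alg) set normed_star_alg" where
  "graph_cstar E = completion (free_star_algebra (generators E)) (cuntz_krieger_seminorm E)"

definition cstar_generator ::
  "('v, 'e) pre_digraph \<Rightarrow> ('v, 'e) generator \<Rightarrow> (nat \<Rightarrow> ('v, 'e) free_alg) set" where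
  "cstar_generator E g =
     to_completion (free_star_algebra (generators E)) (cuntz_krieger_seminorm E) (gen g)"

definition leavitt_generator ::
  "('v, 'e) pre_digraph \<Rightarrow> ('v, 'e) generator \<Rightarrow> ('v, 'e) free_alg set" where
  "leavitt_generator E g = coset (free_star_algebra (generators E))
     (ideal_gen (free_star_algebra (generators E)) (leavitt_relators E)) (gen g)"

text \<open>
  The canonical map \<open>\<iota>\<^sub>E\<close>; all representatives of a coset have the same image.
\<close>

definition leavitt_to_cstar ::
  "('v, 'e) pre_digraph \<Rightarrow> ('v, 'e) free_alg set \<Rightarrow> (nat \<Rightarrow> ('v, 'e) free_alg) set" where
  "leavitt_to_cstar E = (\<lambda>X\<in>carrier (leavitt_path_algebra E).
     \<Union>x\<in>X. to_completion (free_star_algebra (generators E)) (cuntz_krieger_seminorm E) x)"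


section \<open>Validity of the constructions\<close>

subsection \<open>Quotients\<close>

context star_algebra
begin

lemmas clos = smult_closed mult_closed adj_closed a_closed zero_closed a_inv_closed minus_closed

lemma add_eq_selfD: "x \<in> carrier A \<Longrightarrow> x \<oplus> x = x \<Longrightarrow> x = \<zero>"
  using add.l_cancel_one' by metis

lemma mult_zero_l: "x \<in> carrier A \<Longrightarrow> \<zero> \<otimes> x = \<zero>"
  by (rule add_eq_selfD) (simp_all add: clos flip: mult_l_distr)

lemma mult_zero_r: "x \<in> carrier A \<Longrightarrow> x \<otimes> \<zero> = \<zero>"
  by (rule add_eq_selfD) (simp_all add: clos flip: mult_r_distr)

lemma smult_zero: "c \<odot> \<zero> = \<zero>"
  by (rule add_eq_selfD) (simp_all add: clos flip: smult_r_distr)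

lemma zero_smult: "x \<in> carrier A \<Longrightarrow> 0 \<odot> x = \<zero>"
  by (rule add_eq_selfD) (simp_all add: clos flip: smult_l_distr)

lemma adj_zero: "\<zero>\<^sup>\<star> = \<zero>"
  by (rule add_eq_selfD) (simp_all add: clos flip: adj_add)

lemma minus_eq_smult: "x \<in> carrier A \<Longrightarrow> \<ominus> x = (-1) \<odot> x"
proof -
  assume x: "x \<in> carrier A"
  have "(-1) \<odot> x \<oplus> x = (-1) \<odot> x \<oplus> 1 \<odot> x" using x by (simp add: smult_one)
  also have "\<dots> = \<zero>" using x by (simp add: zero_smult flip: smult_l_distr)
  finally show ?thesis using x by (simp add: minus_equality clos)
qed

lemma diff_eq: "x \<in> carrier A \<Longrightarrow> y \<in> carrier A \<Longrightarrow> x \<ominus> y = x \<oplus> (-1) \<odot> y"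
  by (simp add: a_minus_def minus_eq_smult)

lemma mult_diff_r: "x \<in> carrier A \<Longrightarrow> y \<in> carrier A \<Longrightarrow> z \<in> carrier A \<Longrightarrow> x \<otimes> (y \<ominus> z) = x \<otimes> y \<ominus> x \<otimes> z"
  by (simp add: diff_eq clos mult_r_distr smult_mult_r)

lemma mult_diff_l: "x \<in> carrier A \<Longrightarrow> y \<in> carrier A \<Longrightarrow> z \<in> carrier A \<Longrightarrow> (x \<ominus> y) \<otimes> z = x \<otimes> z \<ominus> y \<otimes> z"
  by (simp add: diff_eq clos mult_l_distr smult_mult_l)

lemma smult_diff: "x \<in> carrier A \<Longrightarrow> y \<in> carrier A \<Longrightarrow> c \<odot> (x \<ominus> y) = c \<odot> x \<ominus> c \<odot> y"
  by (simp add: diff_eq clos smult_r_distr mult.commute flip: smult_assoc)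

lemma adj_diff: "x \<in> carrier A \<Longrightarrow> y \<in> carrier A \<Longrightarrow> (x \<ominus> y)\<^sup>\<star> = x\<^sup>\<star> \<ominus> y\<^sup>\<star>"
  by (simp add: diff_eq clos adj_add adj_smult)

lemma diff_self: "x \<in> carrier A \<Longrightarrow> x \<ominus> x = \<zero>"
  by (simp add: a_minus_def r_neg)

lemma diff_zero: "x \<in> carrier A \<Longrightarrow> x \<ominus> \<zero> = x"
  by (simp add: diff_eq smult_zero)

lemma add_diff_cancel: "x \<in> carrier A \<Longrightarrow> y \<in> carrier A \<Longrightarrow> x \<oplus> (y \<ominus> x) = y"
  by (simp add: a_minus_def a_lcomm[of x y] r_neg)

lemma diff_eq_zeroD: "x \<in> carrier A \<Longrightarrow> y \<in> carrier A \<Longrightarrow> x \<ominus> y = \<zero> \<Longrightarrow> x = y"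
  by (metis add_diff_cancel r_zero)

lemma diff_diff_trans: "x \<in> carrier A \<Longrightarrow> y \<in> carrier A \<Longrightarrow> z \<in> carrier A \<Longrightarrow> (x \<ominus> y) \<oplus> (y \<ominus> z) = x \<ominus> z"
proof -
  assume c: "x \<in> carrier A" "y \<in> carrier A" "z \<in> carrier A"
  then have "(x \<ominus> y) \<oplus> (y \<ominus> z) = (\<ominus> y \<oplus> x) \<oplus> (y \<ominus> z)" by (simp add: a_minus_def a_comm)
  also have "\<dots> = \<ominus> y \<oplus> (y \<oplus> (x \<oplus> \<ominus> z))" using c by (simp add: a_minus_def a_assoc a_lcomm[of x y])
  also have "\<dots> = (\<ominus> y \<oplus> y) \<oplus> (x \<ominus> z)" using c by (simp add: a_minus_def a_assoc)
  finally show ?thesis using c by (simp add: l_neg)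
qed

lemma diff_minus: "x \<in> carrier A \<Longrightarrow> y \<in> carrier A \<Longrightarrow> (-1) \<odot> (x \<ominus> y) = y \<ominus> x"
  by (simp add: a_minus_def minus_add minus_minus a_comm flip: minus_eq_smult)

lemma add_diff_add: "x \<in> carrier A \<Longrightarrow> y \<in> carrier A \<Longrightarrow> u \<in> carrier A \<Longrightarrow> v \<in> carrier A \<Longrightarrow>
  (x \<oplus> y) \<ominus> (u \<oplus> v) = (x \<ominus> u) \<oplus> (y \<ominus> v)"
  by (simp add: a_minus_def minus_add a_ac clos)

end

locale star_ideal = star_algebra A for A :: "('a, 'm) star_alg_scheme" (structure) +
  fixes I :: "'a set"
  assumes ideal_carrier: "I \<subseteq> carrier A"
    and ideal_zero: "\<zero> \<in> I"
    and ideal_add: "x \<in> I \<Longrightarrow> y \<in> I \<Longrightarrow> x \<oplus> y \<in> I"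
    and ideal_smult: "x \<in> I \<Longrightarrow> c \<odot> x \<in> I"
    and ideal_l_mult: "a \<in> carrier A \<Longrightarrow> x \<in> I \<Longrightarrow> a \<otimes> x \<in> I"
    and ideal_r_mult: "a \<in> carrier A \<Longrightarrow> x \<in> I \<Longrightarrow> x \<otimes> a \<in> I"
    and ideal_adj: "x \<in> I \<Longrightarrow> x\<^sup>\<star> \<in> I"
begin

lemma mem_coset_iff: "x \<in> carrier A \<Longrightarrow> y \<in> coset A I x \<longleftrightarrow> y \<in> carrier A \<and> y \<ominus> x \<in> I"
proof
  assume x: "x \<in> carrier A" and y: "y \<in> coset A I x"
  then obtain i where i: "i \<in> I" "y = x \<oplus> i" by (auto simp: coset_def)
  have "i \<in> carrier A" using i ideal_carrier by auto
  with x i show "y \<in> carrier A \<and> y \<ominus> x \<in> I"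
    by (simp add: a_minus_def a_comm[of x] a_assoc r_neg)
next
  assume "x \<in> carrier A" "y \<in> carrier A \<and> y \<ominus> x \<in> I"
  then show "y \<in> coset A I x"
    unfolding coset_def by (intro image_eqI[of _ _ "y \<ominus> x"]) (auto simp: add_diff_cancel)
qed

lemma ideal_sym: "x \<in> carrier A \<Longrightarrow> y \<in> carrier A \<Longrightarrow> x \<ominus> y \<in> I \<Longrightarrow> y \<ominus> x \<in> I"
  using ideal_smult[of "x \<ominus> y" "-1"] by (simp add: diff_minus)

lemma ideal_trans: "x \<in> carrier A \<Longrightarrow> y \<in> carrier A \<Longrightarrow> z \<in> carrier A \<Longrightarrow>
   x \<ominus> y \<in> I \<Longrightarrow> y \<ominus> z \<in> I \<Longrightarrow> x \<ominus> z \<in> I"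
  using ideal_add[of "x \<ominus> y" "y \<ominus> z"] by (simp add: diff_diff_trans)

lemma coset_self: "x \<in> carrier A \<Longrightarrow> x \<in> coset A I x"
  by (simp add: mem_coset_iff diff_self ideal_zero)

lemma coset_eqI:
  assumes a: "x \<in> carrier A" "y \<in> carrier A" "x \<ominus> y \<in> I"
  shows "coset A I x = coset A I y"
proof -
  have "z \<ominus> x \<in> I \<longleftrightarrow> z \<ominus> y \<in> I" if "z \<in> carrier A" for z
    using ideal_trans[OF that a(1,2) _ a(3)] ideal_trans[OF that a(2,1) _ ideal_sym[OF a]] by metis
  then show ?thesis
    unfolding set_eq_iff mem_coset_iff[OF a(1)] mem_coset_iff[OF a(2)] by metis
qed

lemma coset_eq_iff: "x \<in> carrier A \<Longrightarrow> y \<in> carrier A \<Longrightarrow> coset A I x = coset A I y \<longleftrightarrow> x \<ominus> y \<in> I"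
  using coset_eqI coset_self mem_coset_iff by metis

lemma quotient_add:
  assumes x: "x \<in> carrier A" and y: "y \<in> carrier A"
  shows "coset A I x \<oplus>\<^bsub>quotient_algebra A I\<^esub> coset A I y = coset A I (x \<oplus> y)"
proof -
  have *: "coset A I (x' \<oplus> y') = coset A I (x \<oplus> y)"
    if "x' \<in> coset A I x" "y' \<in> coset A I y" for x' y'
    using that x y by (simp add: mem_coset_iff coset_eq_iff clos add_diff_add ideal_add)
  have "(\<Union>x'\<in>coset A I x. \<Union>y'\<in>coset A I y. coset A I (x' \<oplus> y')) = coset A I (x \<oplus> y)"
    using * coset_self[OF x] coset_self[OF y] by blast
  then show ?thesis by (simp add: quotient_algebra_def)
qed

lemma quotient_smult:
  assumes x: "x \<in> carrier A"
  shows "c \<odot>\<^bsub>quotient_algebra A I\<^esub> coset A I x = coset A I (c \<odot> x)"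
proof -
  have *: "coset A I (c \<odot> x') = coset A I (c \<odot> x)" if "x' \<in> coset A I x" for x'
    using that x by (simp add: mem_coset_iff coset_eq_iff clos ideal_smult flip: smult_diff)
  have "(\<Union>x'\<in>coset A I x. coset A I (c \<odot> x')) = coset A I (c \<odot> x)"
    using * coset_self[OF x] by blast
  then show ?thesis by (simp add: quotient_algebra_def)
qed

lemma quotient_adj:
  assumes x: "x \<in> carrier A"
  shows "(coset A I x)\<^sup>\<star>\<^bsub>quotient_algebra A I\<^esub> = coset A I (x\<^sup>\<star>)"
proof -
  have *: "coset A I (x'\<^sup>\<star>) = coset A I (x\<^sup>\<star>)" if "x' \<in> coset A I x" for x'
    using that x by (simp add: mem_coset_iff coset_eq_iff clos ideal_adj flip: adj_diff)
  have "(\<Union>x'\<in>coset A I x. coset A I (x'\<^sup>\<star>)) = coset A I (x\<^sup>\<star>)"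
    using * coset_self[OF x] by blast
  then show ?thesis by (simp add: quotient_algebra_def)
qed

lemma quotient_mult:
  assumes x: "x \<in> carrier A" and y: "y \<in> carrier A"
  shows "coset A I x \<otimes>\<^bsub>quotient_algebra A I\<^esub> coset A I y = coset A I (x \<otimes> y)"
proof -
  have *: "coset A I (x' \<otimes> y') = coset A I (x \<otimes> y)"
    if "x' \<in> coset A I x" "y' \<in> coset A I y" for x' y'
  proof -
    have c: "x' \<in> carrier A" "x' \<ominus> x \<in> I" "y' \<in> carrier A" "y' \<ominus> y \<in> I"
      using that x y mem_coset_iff by auto
    have "x' \<otimes> y' \<ominus> x' \<otimes> y \<in> I" "x' \<otimes> y \<ominus> x \<otimes> y \<in> I"
      using c x y by (simp_all add: ideal_l_mult ideal_r_mult flip: mult_diff_l mult_diff_r)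
    then have "x' \<otimes> y' \<ominus> x \<otimes> y \<in> I"
      using c x y by (meson ideal_trans mult_closed)
    then show ?thesis using c x y by (simp add: coset_eq_iff clos)
  qed
  have "(\<Union>x'\<in>coset A I x. \<Union>y'\<in>coset A I y. coset A I (x' \<otimes> y')) = coset A I (x \<otimes> y)"
    using * coset_self[OF x] coset_self[OF y] by blast
  then show ?thesis by (simp add: quotient_algebra_def)
qed

lemma quotient_carrier: "carrier (quotient_algebra A I) = coset A I ` carrier A"
  and quotient_zero: "\<zero>\<^bsub>quotient_algebra A I\<^esub> = coset A I \<zero>"
  by (simp_all add: quotient_algebra_def)

lemma star_algebra_quotient: "star_algebra (quotient_algebra A I)"
proof -
  note qs = quotient_add quotient_zero quotient_smult quotient_mult quotient_adj
  note D = quotient_carrier[THEN eqset_imp_iff, THEN iffD1, THEN imageE]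
  have "abelian_group (quotient_algebra A I)"
  proof (rule abelian_groupI)
    fix x assume "x \<in> carrier (quotient_algebra A I)"
    then obtain a where a: "a \<in> carrier A" "x = coset A I a" by (auto simp: quotient_carrier)
    have "coset A I (\<ominus> a) \<oplus>\<^bsub>quotient_algebra A I\<^esub> x = \<zero>\<^bsub>quotient_algebra A I\<^esub>"
      using a by (simp add: qs l_neg)
    then show "\<exists>y\<in>carrier (quotient_algebra A I). y \<oplus>\<^bsub>quotient_algebra A I\<^esub> x = \<zero>\<^bsub>quotient_algebra A I\<^esub>"
      using a by (auto simp: quotient_carrier)
  next
    fix x y assume "x \<in> carrier (quotient_algebra A I)" "y \<in> carrier (quotient_algebra A I)"
    then show "x \<oplus>\<^bsub>quotient_algebra A I\<^esub> y = y \<oplus>\<^bsub>quotient_algebra A I\<^esub> x"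
      by (elim D) (simp add: qs a_comm)
  qed (auto elim!: D simp: qs quotient_carrier a_assoc)
  then show ?thesis
    by (intro star_algebra.intro star_algebra_axioms.intro; (assumption | (elim D)?))
       (simp_all add: quotient_carrier qs clos smult_l_distr smult_r_distr smult_assoc smult_one mult_assoc
         mult_l_distr mult_r_distr smult_mult_l smult_mult_r adj_adj adj_add adj_smult adj_mult)
qed

end


subsection \<open>Completions\<close>

locale seminormed_star_algebra = star_algebra A for A :: "('a, 'm) star_alg_scheme" (structure) +
  fixes q :: "'a \<Rightarrow> real"
  assumes seminorm: "cstar_seminorm A q"
begin

lemma q_triangle: "x \<in> carrier A \<Longrightarrow> y \<in> carrier A \<Longrightarrow> q (x \<oplus> y) \<le> q x + q y"
  and q_smult: "x \<in> carrier A \<Longrightarrow> q (c \<odot> x) = cmod c * q x"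
  and q_mult: "x \<in> carrier A \<Longrightarrow> y \<in> carrier A \<Longrightarrow> q (x \<otimes> y) \<le> q x * q y"
  and q_cstar: "x \<in> carrier A \<Longrightarrow> q (x\<^sup>\<star> \<otimes> x) = (q x)\<^sup>2"
  using seminorm by (simp_all add: cstar_seminorm_def)

lemma q_zero: "q \<zero> = 0"
  using q_smult[of \<zero> 0] by (simp add: smult_zero)

lemma q_diff_commute: "x \<in> carrier A \<Longrightarrow> y \<in> carrier A \<Longrightarrow> q (x \<ominus> y) = q (y \<ominus> x)"
  using q_smult[of "x \<ominus> y" "-1"] by (simp add: diff_minus)

lemma q_nonneg: "x \<in> carrier A \<Longrightarrow> 0 \<le> q x"
  using q_triangle[of x "(-1) \<odot> x"] q_smult[of x "-1"] diff_self[of x]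
  by (simp add: diff_eq smult_closed q_zero)

lemma q_diff_triangle: "x \<in> carrier A \<Longrightarrow> y \<in> carrier A \<Longrightarrow> z \<in> carrier A \<Longrightarrow>
   q (x \<ominus> z) \<le> q (x \<ominus> y) + q (y \<ominus> z)"
  using q_triangle[of "x \<ominus> y" "y \<ominus> z"] by (simp add: diff_diff_trans)

lemma q_abs_diff:
  assumes x: "x \<in> carrier A" and y: "y \<in> carrier A"
  shows "\<bar>q x - q y\<bar> \<le> q (x \<ominus> y)"
  using q_diff_triangle[of x y \<zero>] q_diff_triangle[of y x \<zero>] q_diff_commute[of x y] x y
  by (simp add: diff_zero)

lemma q_adj:
  assumes x: "x \<in> carrier A"
  shows "q (x\<^sup>\<star>) = q x"
proof -
  have *: "q y \<le> q (y\<^sup>\<star>)" if "y \<in> carrier A" for y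
  proof -
    have "q y * q y \<le> q (y\<^sup>\<star>) * q y"
      using q_mult[of "y\<^sup>\<star>" y] q_cstar[of y] that by (simp add: adj_closed power2_eq_square)
    moreover have "0 \<le> q y" "0 \<le> q (y\<^sup>\<star>)" using that by (simp_all add: q_nonneg adj_closed)
    ultimately show ?thesis by (metis mult_le_cancel_right order.trans linorder_not_le)
  qed
  show ?thesis using *[OF x] *[OF adj_closed[OF x]] x by (simp add: adj_adj)
qed

lemma cauchy_carrier: "X \<in> cauchy_seqs A q \<Longrightarrow> X n \<in> carrier A"
  by (simp add: cauchy_seqs_def)

lemma cauchyD: "X \<in> cauchy_seqs A q \<Longrightarrow> e > 0 \<Longrightarrow> \<exists>N. \<forall>m\<ge>N. \<forall>n\<ge>N. q (X m \<ominus> X n) < e"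
  by (simp add: cauchy_seqs_def)

lemma cauchyI: "(\<And>n. X n \<in> carrier A) \<Longrightarrow>
  (\<And>e. e > 0 \<Longrightarrow> \<exists>N. \<forall>m\<ge>N. \<forall>n\<ge>N. q (X m \<ominus> X n) < e) \<Longrightarrow> X \<in> cauchy_seqs A q"
  by (simp add: cauchy_seqs_def)

lemma cauchy_const: "x \<in> carrier A \<Longrightarrow> (\<lambda>_. x) \<in> cauchy_seqs A q"
  by (simp add: cauchy_seqs_def diff_self q_zero)

lemma cauchy_bounded:
  assumes X: "X \<in> cauchy_seqs A q"
  obtains K where "K > 0" "\<And>n. q (X n) \<le> K"
proof -
  obtain N where N: "\<And>m n. m \<ge> N \<Longrightarrow> n \<ge> N \<Longrightarrow> q (X m \<ominus> X n) < 1"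
    using cauchyD[OF X, of 1] by auto
  define K where "K = 1 + q (X N) + (\<Sum>n<N. q (X n))"
  have pos: "q (X n) \<ge> 0" for n using X by (simp add: q_nonneg cauchy_carrier)
  have "q (X n) \<le> K" for n
  proof (cases "n < N")
    case True
    then have "q (X n) \<le> (\<Sum>n<N. q (X n))" using pos by (intro member_le_sum) auto
    then show ?thesis using pos[of N] by (simp add: K_def)
  next
    case False
    then have "q (X n) - q (X N) < 1"
      using N[of n N] q_abs_diff[of "X n" "X N"] X by (simp add: cauchy_carrier)
    moreover have "(\<Sum>n<N. q (X n)) \<ge> 0" using pos by (intro sum_nonneg) auto
    ultimately show ?thesis by (simp add: K_def)
  qed
  moreover have "K > 0" unfolding K_def using pos by (intro add_pos_nonneg sum_nonneg) auto
  ultimately show thesis by (rule that[rotated])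
qed

lemma cauchy_lipschitz:
  assumes X: "X \<in> cauchy_seqs A q" and Y: "Y \<in> cauchy_seqs A q"
    and Z: "\<And>n. Z n \<in> carrier A"
    and K: "K > 0" "\<And>m n. q (Z m \<ominus> Z n) \<le> K * (q (X m \<ominus> X n) + q (Y m \<ominus> Y n))"
  shows "Z \<in> cauchy_seqs A q"
proof (rule cauchyI)
  show "\<And>n. Z n \<in> carrier A" by (fact Z)
next
  fix e :: real assume e: "e > 0"
  define d where "d = e / (2 * K)"
  have d: "d > 0" using e K by (simp add: d_def)
  obtain N M where N: "\<And>m n. m \<ge> N \<Longrightarrow> n \<ge> N \<Longrightarrow> q (X m \<ominus> X n) < d"
    and M: "\<And>m n. m \<ge> M \<Longrightarrow> n \<ge> M \<Longrightarrow> q (Y m \<ominus> Y n) < d"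
    using cauchyD[OF X d] cauchyD[OF Y d] by metis
  have "q (Z m \<ominus> Z n) < e" if "m \<ge> max M N" "n \<ge> max M N" for m n
  proof -
    have "q (X m \<ominus> X n) + q (Y m \<ominus> Y n) < d + d"
      using N[of m n] M[of m n] that by (intro add_strict_mono) auto
    then have "K * (q (X m \<ominus> X n) + q (Y m \<ominus> Y n)) < K * (d + d)"
      using K(1) by simp
    also have "\<dots> = e" using K(1) by (simp add: d_def field_simps)
    finally show ?thesis using K(2)[of m n] by simp
  qed
  then show "\<exists>N. \<forall>m\<ge>N. \<forall>n\<ge>N. q (Z m \<ominus> Z n) < e" by blast
qed

lemma cauchy_add:
  assumes X: "X \<in> cauchy_seqs A q" and Y: "Y \<in> cauchy_seqs A q"
  shows "(\<lambda>n. X n \<oplus> Y n) \<in> cauchy_seqs A q"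
  by (rule cauchy_lipschitz[OF X Y, of _ 1])
     (use X Y in \<open>simp_all add: cauchy_carrier add_diff_add q_triangle\<close>)

lemma cauchy_smult:
  assumes X: "X \<in> cauchy_seqs A q"
  shows "(\<lambda>n. c \<odot> X n) \<in> cauchy_seqs A q"
proof (rule cauchy_lipschitz[OF X X, of _ "cmod c + 1"])
  show "\<And>n. c \<odot> X n \<in> carrier A" using X by (simp add: cauchy_carrier smult_closed)
  show "cmod c + 1 > 0" by (simp add: add_nonneg_pos)
  fix m n
  have "q (X m \<ominus> X n) \<ge> 0" using X by (simp add: cauchy_carrier q_nonneg)
  then have "cmod c * q (X m \<ominus> X n) \<le> (cmod c + 1) * (q (X m \<ominus> X n) + q (X m \<ominus> X n))"
    by (intro mult_mono) auto
  then show "q (c \<odot> X m \<ominus> c \<odot> X n) \<le> (cmod c + 1) * (q (X m \<ominus> X n) + q (X m \<ominus> X n))"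
    using X by (simp add: cauchy_carrier q_smult flip: smult_diff)
qed

lemma cauchy_adj:
  assumes X: "X \<in> cauchy_seqs A q"
  shows "(\<lambda>n. (X n)\<^sup>\<star>) \<in> cauchy_seqs A q"
  using X by (auto simp: cauchy_seqs_def adj_closed q_adj simp flip: adj_diff)

lemma q_mult_diff_le:
  assumes c: "x \<in> carrier A" "y \<in> carrier A" "x' \<in> carrier A" "y' \<in> carrier A"
    and K: "q x \<le> K" "q y' \<le> K"
  shows "q (x \<otimes> y \<ominus> x' \<otimes> y') \<le> K * (q (x \<ominus> x') + q (y \<ominus> y'))"
proof -
  have "q (x \<otimes> y \<ominus> x' \<otimes> y') \<le> q (x \<otimes> (y \<ominus> y')) + q ((x \<ominus> x') \<otimes> y')"
    using c q_diff_triangle[of "x \<otimes> y" "x \<otimes> y'" "x' \<otimes> y'"] by (simp add: mult_closed mult_diff_r mult_diff_l)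
  also have "\<dots> \<le> q x * q (y \<ominus> y') + q (x \<ominus> x') * q y'"
    using c by (intro add_mono q_mult) auto
  also have "\<dots> \<le> K * q (y \<ominus> y') + q (x \<ominus> x') * K"
    using c K by (intro add_mono mult_right_mono mult_left_mono) (simp_all add: q_nonneg)
  finally show ?thesis by (simp add: algebra_simps)
qed

lemma cauchy_mult:
  assumes X: "X \<in> cauchy_seqs A q" and Y: "Y \<in> cauchy_seqs A q"
  shows "(\<lambda>n. X n \<otimes> Y n) \<in> cauchy_seqs A q"
proof -
  obtain K L where K: "K > 0" "\<And>n. q (X n) \<le> K" and L: "L > 0" "\<And>n. q (Y n) \<le> L"
    using cauchy_bounded[OF X] cauchy_bounded[OF Y] by metis
  show ?thesis
  proof (rule cauchy_lipschitz[OF X Y, of _ "K + L"])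
    show "\<And>n. X n \<otimes> Y n \<in> carrier A" using X Y by (simp add: cauchy_carrier mult_closed)
    show "K + L > 0" using K L by simp
    show "q (X m \<otimes> Y m \<ominus> X n \<otimes> Y n) \<le> (K + L) * (q (X m \<ominus> X n) + q (Y m \<ominus> Y n))" for m n
      using X Y K(1) L(1) K(2)[of m] L(2)[of n] by (intro q_mult_diff_le) (simp_all add: cauchy_carrier)
  qed
qed

lemma star_algebra_cauchy: "star_algebra (cauchy_algebra A q)"
proof -
  have "abelian_group (cauchy_algebra A q)"
  proof (rule abelian_groupI)
    fix X assume X: "X \<in> carrier (cauchy_algebra A q)"
    have "(\<lambda>n. (-1) \<odot> X n) \<oplus>\<^bsub>cauchy_algebra A q\<^esub> X = \<zero>\<^bsub>cauchy_algebra A q\<^esub>"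
      using X by (auto simp: cauchy_algebra_def fun_eq_iff cauchy_carrier l_neg simp flip: minus_eq_smult)
    moreover have "(\<lambda>n. (-1) \<odot> X n) \<in> carrier (cauchy_algebra A q)"
      using X by (simp add: cauchy_algebra_def cauchy_smult)
    ultimately show "\<exists>Y\<in>carrier (cauchy_algebra A q).
        Y \<oplus>\<^bsub>cauchy_algebra A q\<^esub> X = \<zero>\<^bsub>cauchy_algebra A q\<^esub>" by blast
  next
    fix X Y assume "X \<in> carrier (cauchy_algebra A q)" "Y \<in> carrier (cauchy_algebra A q)"
    then show "X \<oplus>\<^bsub>cauchy_algebra A q\<^esub> Y = Y \<oplus>\<^bsub>cauchy_algebra A q\<^esub> X"
      by (auto simp: cauchy_algebra_def cauchy_carrier fun_eq_iff intro!: a_comm)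
  qed (auto simp: cauchy_algebra_def cauchy_add cauchy_const cauchy_carrier a_assoc)
  then show ?thesis
    by (intro star_algebra.intro star_algebra_axioms.intro)
       (simp_all add: cauchy_algebra_def cauchy_add cauchy_mult cauchy_smult cauchy_adj cauchy_carrier
         smult_l_distr smult_r_distr smult_assoc smult_one mult_assoc
         mult_l_distr mult_r_distr smult_mult_l smult_mult_r adj_adj adj_add adj_smult adj_mult)
qed

lemma null_squeeze:
  assumes "(\<lambda>n. f n) \<longlonglongrightarrow> (0::real)" "\<And>n. X n \<in> carrier A" "\<And>n. q (X n) \<le> f n"
  shows "X \<in> null_seqs A q"
proof -
  have "(\<lambda>n. q (X n)) \<longlonglongrightarrow> 0"
    by (rule tendsto_sandwich[OF _ _ tendsto_const assms(1)]) (use assms in \<open>simp_all add: q_nonneg\<close>)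
  then show ?thesis using assms by (simp add: null_seqs_def)
qed

lemma null_carrier: "X \<in> null_seqs A q \<Longrightarrow> X n \<in> carrier A"
  and null_lim: "X \<in> null_seqs A q \<Longrightarrow> (\<lambda>n. q (X n)) \<longlonglongrightarrow> 0"
  by (simp_all add: null_seqs_def)

lemma null_cauchy:
  assumes X: "X \<in> null_seqs A q"
  shows "X \<in> cauchy_seqs A q"
proof (rule cauchyI)
  show "\<And>n. X n \<in> carrier A" using X by (rule null_carrier)
  fix e :: real assume "e > 0"
  then have "e / 2 > 0" by simp
  then obtain N where N: "\<And>n. n \<ge> N \<Longrightarrow> norm (q (X n)) < e / 2"
    using LIMSEQ_D[OF null_lim[OF X], of "e / 2"] by auto
  have "q (X m \<ominus> X n) < e" if "m \<ge> N" "n \<ge> N" for m n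
  proof -
    have "q (X m \<ominus> X n) \<le> q (X m) + q (X n)"
      using q_triangle[of "X m" "(-1) \<odot> X n"] null_carrier[OF X]
      by (simp add: diff_eq smult_closed q_smult)
    then show ?thesis using N[of m] N[of n] that by simp
  qed
  then show "\<exists>N. \<forall>m\<ge>N. \<forall>n\<ge>N. q (X m \<ominus> X n) < e" by blast
qed

sublocale C: star_ideal "cauchy_algebra A q" "null_seqs A q"
proof (intro star_ideal.intro star_algebra_cauchy star_ideal_axioms.intro)
  show "null_seqs A q \<subseteq> carrier (cauchy_algebra A q)"
    by (auto simp: cauchy_algebra_def null_cauchy)
  show "\<zero>\<^bsub>cauchy_algebra A q\<^esub> \<in> null_seqs A q"
    by (simp add: cauchy_algebra_def null_seqs_def q_zero)
  fix X assume X: "X \<in> null_seqs A q"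
  show "X \<oplus>\<^bsub>cauchy_algebra A q\<^esub> Y \<in> null_seqs A q" if "Y \<in> null_seqs A q" for Y
    using tendsto_add[OF null_lim[OF X] null_lim[OF that]] null_carrier[OF X] null_carrier[OF that]
    unfolding cauchy_algebra_def by (auto intro: null_squeeze simp: q_triangle)
  show "c \<odot>\<^bsub>cauchy_algebra A q\<^esub> X \<in> null_seqs A q" for c
    using tendsto_mult_left[OF null_lim[OF X], of "cmod c"] null_carrier[OF X]
    unfolding cauchy_algebra_def by (auto intro: null_squeeze simp: q_smult smult_closed)
  show "X\<^sup>\<star>\<^bsub>cauchy_algebra A q\<^esub> \<in> null_seqs A q"
    using null_lim[OF X] null_carrier[OF X]
    unfolding cauchy_algebra_def by (auto intro: null_squeeze simp: q_adj adj_closed)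
  fix Y assume "Y \<in> carrier (cauchy_algebra A q)"
  then have Y: "Y \<in> cauchy_seqs A q" by (simp add: cauchy_algebra_def)
  obtain K where K: "K > 0" "\<And>n. q (Y n) \<le> K" using cauchy_bounded[OF Y] by blast
  have lim: "(\<lambda>n. K * q (X n)) \<longlonglongrightarrow> 0"
    using tendsto_mult_left[OF null_lim[OF X], of K] by simp
  have le: "q (Y n) * q (X n) \<le> K * q (X n)" for n
    using K null_carrier[OF X] by (simp add: mult_right_mono q_nonneg)
  show "Y \<otimes>\<^bsub>cauchy_algebra A q\<^esub> X \<in> null_seqs A q"
  proof -
    have "q (Y n \<otimes> X n) \<le> K * q (X n)" for n
      using le[of n] q_mult[of "Y n" "X n"] null_carrier[OF X] cauchy_carrier[OF Y] by force
    then show ?thesis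
      using lim null_carrier[OF X] cauchy_carrier[OF Y]
      unfolding cauchy_algebra_def by (auto intro: null_squeeze simp: mult_closed)
  qed
  show "X \<otimes>\<^bsub>cauchy_algebra A q\<^esub> Y \<in> null_seqs A q"
  proof -
    have "q (X n \<otimes> Y n) \<le> K * q (X n)" for n
      using le[of n] q_mult[of "X n" "Y n"] null_carrier[OF X] cauchy_carrier[OF Y]
      by (smt (verit) mult.commute)
    then show ?thesis
      using lim null_carrier[OF X] cauchy_carrier[OF Y]
      unfolding cauchy_algebra_def by (auto intro: null_squeeze simp: mult_closed)
  qed
qed

abbreviation cls :: "(nat \<Rightarrow> 'a) \<Rightarrow> (nat \<Rightarrow> 'a) set" where
  "cls \<equiv> coset (cauchy_algebra A q) (null_seqs A q)"

lemma cauchy_simps: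
  "carrier (cauchy_algebra A q) = cauchy_seqs A q"
  "X \<oplus>\<^bsub>cauchy_algebra A q\<^esub> Y = (\<lambda>n. X n \<oplus> Y n)"
  "X \<otimes>\<^bsub>cauchy_algebra A q\<^esub> Y = (\<lambda>n. X n \<otimes> Y n)"
  "c \<odot>\<^bsub>cauchy_algebra A q\<^esub> X = (\<lambda>n. c \<odot> X n)"
  "X\<^sup>\<star>\<^bsub>cauchy_algebra A q\<^esub> = (\<lambda>n. (X n)\<^sup>\<star>)"
  "\<zero>\<^bsub>cauchy_algebra A q\<^esub> = (\<lambda>n. \<zero>)"
  by (simp_all add: cauchy_algebra_def)

lemma cauchy_diff:
  assumes X: "X \<in> cauchy_seqs A q" and Y: "Y \<in> cauchy_seqs A q"
  shows "X \<ominus>\<^bsub>cauchy_algebra A q\<^esub> Y = (\<lambda>n. X n \<ominus> Y n)"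
  using X Y by (simp add: C.diff_eq cauchy_simps diff_eq cauchy_carrier)

lemma completion_simps:
  "carrier (completion A q) = cls ` cauchy_seqs A q"
  "\<zero>\<^bsub>completion A q\<^esub> = cls (\<lambda>_. \<zero>)"
  "X \<in> cauchy_seqs A q \<Longrightarrow> Y \<in> cauchy_seqs A q \<Longrightarrow>
     cls X \<oplus>\<^bsub>completion A q\<^esub> cls Y = cls (\<lambda>n. X n \<oplus> Y n)"
  "X \<in> cauchy_seqs A q \<Longrightarrow> Y \<in> cauchy_seqs A q \<Longrightarrow>
     cls X \<otimes>\<^bsub>completion A q\<^esub> cls Y = cls (\<lambda>n. X n \<otimes> Y n)"
  "X \<in> cauchy_seqs A q \<Longrightarrow> c \<odot>\<^bsub>completion A q\<^esub> cls X = cls (\<lambda>n. c \<odot> X n)"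
  "X \<in> cauchy_seqs A q \<Longrightarrow> (cls X)\<^sup>\<star>\<^bsub>completion A q\<^esub> = cls (\<lambda>n. (X n)\<^sup>\<star>)"
  using C.quotient_carrier C.quotient_zero C.quotient_add[of X Y] C.quotient_mult[of X Y]
    C.quotient_smult[of X c] C.quotient_adj[of X]
  by (simp_all add: completion_def star_alg.defs cauchy_simps)

lemma cls_eq_iff: "X \<in> cauchy_seqs A q \<Longrightarrow> Y \<in> cauchy_seqs A q \<Longrightarrow>
   cls X = cls Y \<longleftrightarrow> (\<lambda>n. q (X n \<ominus> Y n)) \<longlonglongrightarrow> 0"
  using C.coset_eq_iff[of X Y] by (auto simp: cauchy_simps cauchy_diff null_seqs_def cauchy_carrier)

lemma cauchy_q_convergent:
  assumes X: "X \<in> cauchy_seqs A q"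
  shows "convergent (\<lambda>n. q (X n))"
proof -
  have "Cauchy (\<lambda>n. q (X n))"
  proof (rule CauchyI)
    fix e :: real assume e: "e > 0"
    obtain N where N: "\<And>m n. m \<ge> N \<Longrightarrow> n \<ge> N \<Longrightarrow> q (X m \<ominus> X n) < e"
      using cauchyD[OF X e] by auto
    have "norm (q (X m) - q (X n)) < e" if "m \<ge> N" "n \<ge> N" for m n
      using N[OF that] q_abs_diff[of "X m" "X n"] cauchy_carrier[OF X]
      by (metis order_le_less_trans real_norm_def)
    then show "\<exists>M. \<forall>m\<ge>M. \<forall>n\<ge>M. norm (q (X m) - q (X n)) < e" by blast
  qed
  then show ?thesis by (rule Cauchy_convergent)
qed

lemma completion_nrm:
  assumes X: "X \<in> cauchy_seqs A q"
  shows "(\<lambda>n. q (X n)) \<longlonglongrightarrow> nrm (completion A q) (cls X)"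
proof -
  define Y where "Y = (SOME Y. Y \<in> cls X)"
  have "X \<in> cls X" using X by (simp add: C.coset_self cauchy_simps)
  then have "Y \<in> cls X" unfolding Y_def using someI[of "\<lambda>Y. Y \<in> cls X" X] by blast
  then have Y: "Y \<in> cauchy_seqs A q" "cls Y = cls X"
    using X C.mem_coset_iff[of X Y] C.coset_eqI[of Y X] by (simp_all add: cauchy_simps)
  then have "(\<lambda>n. q (Y n \<ominus> X n)) \<longlonglongrightarrow> 0" using X by (simp add: cls_eq_iff)
  then have "(\<lambda>n. q (X n) - q (Y n)) \<longlonglongrightarrow> 0"
    by (rule metric_tendsto_imp_tendsto)
       (use X Y q_abs_diff[of "Y _" "X _"] q_nonneg in
         \<open>auto simp: cauchy_carrier abs_minus_commute dist_real_def intro!: always_eventually\<close>)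
  moreover have "(\<lambda>n. q (Y n)) \<longlonglongrightarrow> lim (\<lambda>n. q (Y n))"
    using cauchy_q_convergent[OF Y(1)] by (simp add: convergent_LIMSEQ_iff)
  ultimately have "(\<lambda>n. q (X n)) \<longlonglongrightarrow> lim (\<lambda>n. q (Y n))"
    using tendsto_add by fastforce
  then show ?thesis by (simp add: completion_def star_alg.defs Y_def)
qed

lemma completion_nrm_const: "x \<in> carrier A \<Longrightarrow> nrm (completion A q) (cls (\<lambda>_. x)) = q x"
  using LIMSEQ_unique[OF completion_nrm[OF cauchy_const] tendsto_const] by blast

lemma star_algebra_completion: "star_algebra (completion A q)"
proof -
  interpret Q: star_algebra "quotient_algebra (cauchy_algebra A q) (null_seqs A q)"
    by (rule C.star_algebra_quotient)
  have "abelian_group (completion A q)"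
  proof (rule abelian_groupI)
    fix x assume "x \<in> carrier (completion A q)"
    then show "\<exists>y\<in>carrier (completion A q). y \<oplus>\<^bsub>completion A q\<^esub> x = \<zero>\<^bsub>completion A q\<^esub>"
      unfolding completion_def star_alg.defs using Q.l_neg Q.a_inv_closed by auto
  next
    fix x y assume "x \<in> carrier (completion A q)" "y \<in> carrier (completion A q)"
    then show "x \<oplus>\<^bsub>completion A q\<^esub> y = y \<oplus>\<^bsub>completion A q\<^esub> x"
      unfolding completion_def star_alg.defs using Q.a_comm by simp
  qed (auto simp: completion_def star_alg.defs Q.a_assoc)
  then show ?thesis
    using Q.star_algebra_axioms
    unfolding star_algebra_def star_algebra_axioms_def completion_def
    by (simp add: star_alg.defs)
qed

lemma completion_diff:
  assumes X: "X \<in> cauchy_seqs A q" and Y: "Y \<in> cauchy_seqs A q"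
  shows "cls X \<ominus>\<^bsub>completion A q\<^esub> cls Y = cls (\<lambda>n. X n \<ominus> Y n)"
proof -
  interpret Q: star_algebra "completion A q" by (rule star_algebra_completion)
  show ?thesis
    using X Y by (simp add: Q.diff_eq completion_simps cauchy_smult diff_eq cauchy_carrier)
qed

lemma cauchy_seqs_diff:
  assumes X: "X \<in> cauchy_seqs A q" and Y: "Y \<in> cauchy_seqs A q"
  shows "(\<lambda>n. X n \<ominus> Y n) \<in> cauchy_seqs A q"
  using cauchy_add[OF X cauchy_smult[OF Y, of "-1"]] X Y by (simp add: diff_eq cauchy_carrier)

lemma completion_approx:
  assumes X: "X \<in> cauchy_seqs A q" and e: "e > 0"
    and N: "\<And>m n. m \<ge> N \<Longrightarrow> n \<ge> N \<Longrightarrow> q (X m \<ominus> X n) < e"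
  shows "nrm (completion A q) (cls X \<ominus>\<^bsub>completion A q\<^esub> cls (\<lambda>_. X N)) \<le> e"
proof -
  have c: "(\<lambda>_. X N) \<in> cauchy_seqs A q" using X by (simp add: cauchy_const cauchy_carrier)
  have "(\<lambda>n. q (X n \<ominus> X N)) \<longlonglongrightarrow> nrm (completion A q) (cls (\<lambda>n. X n \<ominus> X N))"
    by (rule completion_nrm[OF cauchy_seqs_diff[OF X c]])
  then have "nrm (completion A q) (cls (\<lambda>n. X n \<ominus> X N)) \<le> e"
    by (rule LIMSEQ_le_const2) (use N in \<open>auto intro!: exI[of _ N] less_imp_le\<close>)
  then show ?thesis using completion_diff[OF X c] by simp
qed

lemma completion_dense:
  assumes x: "x \<in> carrier (completion A q)" and e: "e > 0"
  shows "\<exists>a\<in>carrier A. nrm (completion A q) (x \<ominus>\<^bsub>completion A q\<^esub> to_completion A q a) < e"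
proof -
  obtain X where X: "X \<in> cauchy_seqs A q" "x = cls X" using x by (auto simp: completion_simps)
  have "e / 2 > 0" using e by simp
  obtain N where "\<And>m n. m \<ge> N \<Longrightarrow> n \<ge> N \<Longrightarrow> q (X m \<ominus> X n) < e / 2"
    using cauchyD[OF X(1) \<open>e / 2 > 0\<close>] by auto
  from completion_approx[OF X(1) \<open>e / 2 > 0\<close> this]
  have "nrm (completion A q) (x \<ominus>\<^bsub>completion A q\<^esub> to_completion A q (X N)) \<le> e / 2"
    using X by (simp add: to_completion_def)
  then show ?thesis using e cauchy_carrier[OF X(1)] by (intro bexI[of _ "X N"]) auto
qed

lemma completion_complete:
  assumes X: "\<And>n. X n \<in> carrier (completion A q)"
    and Cauchy: "\<And>e. e > 0 \<Longrightarrow> \<exists>N. \<forall>m\<ge>N. \<forall>n\<ge>N.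
      nrm (completion A q) (X m \<ominus>\<^bsub>completion A q\<^esub> X n) < e"
    and tri: "\<And>x y z. x \<in> carrier (completion A q) \<Longrightarrow> y \<in> carrier (completion A q) \<Longrightarrow>
      z \<in> carrier (completion A q) \<Longrightarrow>
      nrm (completion A q) (x \<ominus>\<^bsub>completion A q\<^esub> z) \<le>
        nrm (completion A q) (x \<ominus>\<^bsub>completion A q\<^esub> y) + nrm (completion A q) (y \<ominus>\<^bsub>completion A q\<^esub> z)"
    and sym: "\<And>x y. x \<in> carrier (completion A q) \<Longrightarrow> y \<in> carrier (completion A q) \<Longrightarrow>
      nrm (completion A q) (x \<ominus>\<^bsub>completion A q\<^esub> y) = nrm (completion A q) (y \<ominus>\<^bsub>completion A q\<^esub> x)"
  shows "\<exists>x\<in>carrier (completion A q). (\<lambda>n. nrm (completion A q) (X n \<ominus>\<^bsub>completion A q\<^esub> x)) \<longlonglongrightarrow> 0"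
proof -
  let ?d = "\<lambda>x y. nrm (completion A q) (x \<ominus>\<^bsub>completion A q\<^esub> y)"
  let ?c = "\<lambda>a. cls (\<lambda>_. a)"
  have "\<forall>n. \<exists>a\<in>carrier A. ?d (X n) (?c a) < inverse (real (Suc n))"
    using completion_dense[OF X, unfolded to_completion_def] by simp
  then obtain a where a: "\<And>n. a n \<in> carrier A" "\<And>n. ?d (X n) (?c (a n)) < inverse (real (Suc n))"
    by metis
  have ca: "?c (a n) \<in> carrier (completion A q)" for n
    using a by (auto simp: completion_simps cauchy_const)
  have dcc: "?d (?c (a m)) (?c (a n)) = q (a m \<ominus> a n)" for m n
    using a by (simp add: completion_diff cauchy_const completion_nrm_const)
  have inv: "(\<lambda>n. inverse (real (Suc n))) \<longlonglongrightarrow> 0" by (rule LIMSEQ_inverse_real_of_nat)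
  have a_cauchy: "a \<in> cauchy_seqs A q"
  proof (rule cauchyI)
    fix e :: real assume "e > 0"
    then have e3: "e / 3 > 0" by simp
    obtain N where N: "\<And>m n. m \<ge> N \<Longrightarrow> n \<ge> N \<Longrightarrow> ?d (X m) (X n) < e / 3"
      using Cauchy[OF e3] by auto
    obtain M where M: "\<And>n. n \<ge> M \<Longrightarrow> inverse (real (Suc n)) < e / 3"
      using order_tendstoD(2)[OF inv e3] by (auto simp: eventually_sequentially)
    have "q (a m \<ominus> a n) < e" if "m \<ge> max M N" "n \<ge> max M N" for m n
    proof -
      have "?d (?c (a m)) (?c (a n)) \<le> ?d (?c (a m)) (X m) + ?d (X m) (?c (a n))"
        by (rule tri) (simp_all add: ca X)
      also have "?d (X m) (?c (a n)) \<le> ?d (X m) (X n) + ?d (X n) (?c (a n))"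
        by (rule tri) (simp_all add: ca X)
      finally show ?thesis
        using N[of m n] a(2)[of m] a(2)[of n] M[of m] M[of n] that sym[OF ca X, of m m]
        by (simp add: dcc)
    qed
    then show "\<exists>N. \<forall>m\<ge>N. \<forall>n\<ge>N. q (a m \<ominus> a n) < e" by blast
  qed (fact a(1))
  have cl: "cls a \<in> carrier (completion A q)" using a_cauchy by (simp add: completion_simps)
  have "(\<lambda>n. ?d (X n) (cls a)) \<longlonglongrightarrow> 0"
  proof (rule LIMSEQ_I)
    fix e :: real assume "e > 0"
    then have e3: "e / 3 > 0" by simp
    obtain N where N: "\<And>m n. m \<ge> N \<Longrightarrow> n \<ge> N \<Longrightarrow> q (a m \<ominus> a n) < e / 3"
      using cauchyD[OF a_cauchy e3] by auto
    obtain M where M: "\<And>n. n \<ge> M \<Longrightarrow> inverse (real (Suc n)) < e / 3"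
      using order_tendstoD(2)[OF inv e3] by (auto simp: eventually_sequentially)
    have "norm (?d (X n) (cls a) - 0) < e" if n: "n \<ge> max M N" for n
    proof -
      have "?d (cls a) (?c (a n)) \<le> e / 3"
        by (rule completion_approx[OF a_cauchy e3]) (use N n in auto)
      moreover have "?d (X n) (cls a) \<le> ?d (X n) (?c (a n)) + ?d (?c (a n)) (cls a)"
        by (rule tri) (simp_all add: ca X cl)
      moreover have "?d (X n) (cls a) \<ge> 0"
        using tri[of "X n" "cls a" "X n"] sym[of "X n" "cls a"] tri[of "X n" "X n" "X n"] X cl by simp
      ultimately show ?thesis
        using a(2)[of n] M[of n] n sym[OF ca cl, of n] by simp
    qed
    then show "\<exists>N. \<forall>n\<ge>N. norm (?d (X n) (cls a) - 0) < e" by blast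
  qed
  then show ?thesis using cl by blast
qed

theorem cstar_algebra_completion: "cstar_algebra (completion A q)"
proof -
  interpret Q: star_algebra "completion A q" by (rule star_algebra_completion)
  let ?n = "nrm (completion A q)"
  have elim: thesis if "x \<in> carrier (completion A q)"
      "\<And>X. X \<in> cauchy_seqs A q \<Longrightarrow> x = cls X \<Longrightarrow> thesis" for x thesis
    using that by (auto simp: completion_simps)
  note clim = completion_nrm
  have triangle: "?n (x \<oplus>\<^bsub>completion A q\<^esub> y) \<le> ?n x + ?n y"
    if xy: "x \<in> carrier (completion A q)" "y \<in> carrier (completion A q)" for x y
  proof -
    obtain X where X: "X \<in> cauchy_seqs A q" "x = cls X" using elim[OF xy(1)] by blast
    obtain Y where Y: "Y \<in> cauchy_seqs A q" "y = cls Y" using elim[OF xy(2)] by blast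
    have "?n (cls (\<lambda>n. X n \<oplus> Y n)) \<le> ?n (cls X) + ?n (cls Y)"
      by (rule LIMSEQ_le[OF clim[OF cauchy_add[OF X(1) Y(1)]] tendsto_add[OF clim[OF X(1)] clim[OF Y(1)]]])
         (use X Y in \<open>auto simp: q_triangle cauchy_carrier\<close>)
    then show ?thesis using X Y by (simp add: completion_simps)
  qed
  have smult: "?n (c \<odot>\<^bsub>completion A q\<^esub> x) = cmod c * ?n x"
    if x: "x \<in> carrier (completion A q)" for x c
  proof -
    obtain X where X: "X \<in> cauchy_seqs A q" "x = cls X" using elim[OF x] by blast
    have "(\<lambda>n. q (c \<odot> X n)) \<longlonglongrightarrow> cmod c * ?n (cls X)"
      using tendsto_mult_left[OF clim[OF X(1)], of "cmod c"] X by (simp add: q_smult cauchy_carrier)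
    then show ?thesis
      using LIMSEQ_unique[OF clim[OF cauchy_smult[OF X(1)]]] X by (simp add: completion_simps)
  qed
  have sym: "?n (x \<ominus>\<^bsub>completion A q\<^esub> y) = ?n (y \<ominus>\<^bsub>completion A q\<^esub> x)"
    if "x \<in> carrier (completion A q)" "y \<in> carrier (completion A q)" for x y
    using smult[of "x \<ominus>\<^bsub>completion A q\<^esub> y" "-1"] that by (simp add: Q.diff_minus)
  have tri: "?n (x \<ominus>\<^bsub>completion A q\<^esub> z) \<le> ?n (x \<ominus>\<^bsub>completion A q\<^esub> y) + ?n (y \<ominus>\<^bsub>completion A q\<^esub> z)"
    if "x \<in> carrier (completion A q)" "y \<in> carrier (completion A q)" "z \<in> carrier (completion A q)" for x y z
    using triangle[of "x \<ominus>\<^bsub>completion A q\<^esub> y" "y \<ominus>\<^bsub>completion A q\<^esub> z"] that by (simp add: Q.diff_diff_trans)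
  show ?thesis
  proof (intro cstar_algebra.intro star_algebra_completion cstar_algebra_axioms.intro)
    fix x assume x: "x \<in> carrier (completion A q)"
    obtain X where X: "X \<in> cauchy_seqs A q" "x = cls X" using elim[OF x] by blast
    show "?n x = 0 \<longleftrightarrow> x = \<zero>\<^bsub>completion A q\<^esub>"
    proof -
      have "?n x = 0 \<longleftrightarrow> (\<lambda>n. q (X n)) \<longlonglongrightarrow> 0"
        using clim[OF X(1)] X LIMSEQ_unique by metis
      also have "\<dots> \<longleftrightarrow> cls X = cls (\<lambda>_. \<zero>)"
        using X by (simp add: cls_eq_iff cauchy_const diff_zero cauchy_carrier)
      finally show ?thesis using X by (simp add: completion_simps)
    qed
    show "?n (x\<^sup>\<star>\<^bsub>completion A q\<^esub> \<otimes>\<^bsub>completion A q\<^esub> x) = (?n x)\<^sup>2"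
    proof -
      have "(\<lambda>n. q ((X n)\<^sup>\<star> \<otimes> X n)) \<longlonglongrightarrow> (?n (cls X))\<^sup>2"
        using tendsto_power[OF clim[OF X(1)], of 2] X by (simp add: q_cstar cauchy_carrier)
      then show ?thesis
        using LIMSEQ_unique[OF clim[OF cauchy_mult[OF cauchy_adj[OF X(1)] X(1)]]] X
        by (simp add: completion_simps cauchy_adj)
    qed
    fix y assume y: "y \<in> carrier (completion A q)"
    obtain Y where Y: "Y \<in> cauchy_seqs A q" "y = cls Y" using elim[OF y] by blast
    have "?n (cls (\<lambda>n. X n \<otimes> Y n)) \<le> ?n (cls X) * ?n (cls Y)"
      by (rule LIMSEQ_le[OF clim[OF cauchy_mult[OF X(1) Y(1)]] tendsto_mult[OF clim[OF X(1)] clim[OF Y(1)]]])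
         (use X Y in \<open>auto simp: q_mult cauchy_carrier\<close>)
    then show "?n (x \<otimes>\<^bsub>completion A q\<^esub> y) \<le> ?n x * ?n y" using X Y by (simp add: completion_simps)
  next
    fix X :: "nat \<Rightarrow> (nat \<Rightarrow> 'a) set"
    assume "\<And>n. X n \<in> carrier (completion A q)"
      and "\<And>e. 0 < e \<Longrightarrow> \<exists>N. \<forall>m\<ge>N. \<forall>n\<ge>N. ?n (X m \<ominus>\<^bsub>completion A q\<^esub> X n) < e"
    then show "\<exists>x\<in>carrier (completion A q). (\<lambda>n. ?n (X n \<ominus>\<^bsub>completion A q\<^esub> x)) \<longlonglongrightarrow> 0"
      using tri sym by (rule completion_complete)
  qed (use triangle smult in auto)
qed

lemma to_completion_star_hom:
  "restrict (to_completion A q) (carrier A) \<in> star_hom A (completion A q)"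
  by (auto simp: star_hom_def to_completion_def completion_simps cauchy_const clos)

end


subsection \<open>Universal seminorms\<close>

context star_algebra
begin

lemma
  fixes R :: "'a set"
  assumes bounded: "\<And>x. x \<in> carrier A \<Longrightarrow>
    \<exists>M. \<forall>q. cstar_seminorm A q \<and> (\<forall>r\<in>R. q r = 0) \<longrightarrow> q x \<le> M"
  shows universal_seminorm_upper: "\<And>q x. cstar_seminorm A q \<Longrightarrow> (\<forall>r\<in>R. q r = 0) \<Longrightarrow>
      x \<in> carrier A \<Longrightarrow> q x \<le> universal_seminorm A R x"
    and universal_seminorm_zero: "\<And>r. r \<in> R \<Longrightarrow> universal_seminorm A R r = 0"
    and cstar_seminorm_universal: "cstar_seminorm A (universal_seminorm A R)"
proof -
  define Q where "Q = {q. cstar_seminorm A q \<and> (\<forall>r\<in>R. q r = 0)}"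
  have us: "universal_seminorm A R x = (SUP q\<in>Q. q x)" for x
    unfolding universal_seminorm_def Q_def by (rule arg_cong[where f = Sup]) auto
  have ne: "Q \<noteq> {}"
    by (auto simp: Q_def cstar_seminorm_def intro!: exI[of _ "\<lambda>_. 0"])
  have bdd: "bdd_above ((\<lambda>q. q x) ` Q)" if "x \<in> carrier A" for x
    using bounded[OF that] unfolding bdd_above_def Q_def by auto
  have sem: "seminormed_star_algebra A q" if "q \<in> Q" for q
    using that star_algebra_axioms
    by (simp add: Q_def seminormed_star_algebra_def seminormed_star_algebra_axioms_def)
  have up: "q x \<le> universal_seminorm A R x" if "q \<in> Q" "x \<in> carrier A" for q x
    unfolding us using bdd[OF that(2)] that(1) by (intro cSUP_upper) auto
  have least: "universal_seminorm A R x \<le> M" if "\<And>q. q \<in> Q \<Longrightarrow> q x \<le> M" for x M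
    unfolding us using ne that by (intro cSUP_least) auto
  have nonneg: "0 \<le> universal_seminorm A R x" if "x \<in> carrier A" for x
    using ne up[OF _ that] seminormed_star_algebra.q_nonneg[OF sem that] by (meson ex_in_conv order.trans)
  show "\<And>q x. cstar_seminorm A q \<Longrightarrow> (\<forall>r\<in>R. q r = 0) \<Longrightarrow>
      x \<in> carrier A \<Longrightarrow> q x \<le> universal_seminorm A R x"
    using up by (simp add: Q_def)
  show "universal_seminorm A R r = 0" if "r \<in> R" for r
  proof -
    have "(\<lambda>q. q r) ` Q = {0}" using ne that by (auto simp: Q_def image_def)
    then show ?thesis by (simp add: us)
  qed
  show "cstar_seminorm A (universal_seminorm A R)"
    unfolding cstar_seminorm_def
  proof (intro conjI ballI allI)
    fix x y assume x: "x \<in> carrier A" and y: "y \<in> carrier A"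
    show "universal_seminorm A R (x \<oplus> y) \<le> universal_seminorm A R x + universal_seminorm A R y"
    proof (rule least)
      fix q assume q: "q \<in> Q"
      interpret seminormed_star_algebra A q by (rule sem[OF q])
      show "q (x \<oplus> y) \<le> universal_seminorm A R x + universal_seminorm A R y"
        using q_triangle[OF x y] up[OF q x] up[OF q y] by linarith
    qed
    show "universal_seminorm A R (x \<otimes> y) \<le> universal_seminorm A R x * universal_seminorm A R y"
    proof (rule least)
      fix q assume q: "q \<in> Q"
      interpret seminormed_star_algebra A q by (rule sem[OF q])
      have "q x * q y \<le> universal_seminorm A R x * universal_seminorm A R y"
        using up[OF q x] up[OF q y] nonneg[OF x] q_nonneg[OF y] by (intro mult_mono) auto
      then show "q (x \<otimes> y) \<le> universal_seminorm A R x * universal_seminorm A R y"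
        using q_mult[OF x y] by linarith
    qed
  next
    fix c x assume x: "x \<in> carrier A"
    have le: "universal_seminorm A R (d \<odot> z) \<le> cmod d * universal_seminorm A R z"
      if z: "z \<in> carrier A" for d z
    proof (rule least)
      fix q assume q: "q \<in> Q"
      interpret seminormed_star_algebra A q by (rule sem[OF q])
      show "q (d \<odot> z) \<le> cmod d * universal_seminorm A R z"
        using up[OF q z] q_smult[OF z] by (simp add: mult_left_mono)
    qed
    show "universal_seminorm A R (c \<odot> x) = cmod c * universal_seminorm A R x"
    proof (cases "c = 0")
      case True
      then show ?thesis using le[OF x, of 0] nonneg[of "0 \<odot> x"] x by (simp add: smult_closed)
    next
      case False
      have "universal_seminorm A R x \<le> cmod (inverse c) * universal_seminorm A R (c \<odot> x)"
        using le[of "c \<odot> x" "inverse c"] x False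
        by (simp add: smult_closed smult_one flip: smult_assoc)
      then have "cmod c * universal_seminorm A R x \<le> universal_seminorm A R (c \<odot> x)"
        using False by (simp add: norm_divide field_simps)
      then show ?thesis using le[OF x, of c] by simp
    qed
  next
    fix x assume x: "x \<in> carrier A"
    have "universal_seminorm A R (x\<^sup>\<star> \<otimes> x) \<le> (universal_seminorm A R x)\<^sup>2"
    proof (rule least)
      fix q assume q: "q \<in> Q"
      interpret seminormed_star_algebra A q by (rule sem[OF q])
      show "q (x\<^sup>\<star> \<otimes> x) \<le> (universal_seminorm A R x)\<^sup>2"
        using up[OF q x] q_nonneg[OF x] q_cstar[OF x] by (simp add: power_mono)
    qed
    moreover have "(universal_seminorm A R x)\<^sup>2 \<le> universal_seminorm A R (x\<^sup>\<star> \<otimes> x)"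
    proof -
      have xx: "x\<^sup>\<star> \<otimes> x \<in> carrier A" using x by (simp add: clos)
      have "universal_seminorm A R x \<le> sqrt (universal_seminorm A R (x\<^sup>\<star> \<otimes> x))"
      proof (rule least)
        fix q assume q: "q \<in> Q"
        interpret seminormed_star_algebra A q by (rule sem[OF q])
        show "q x \<le> sqrt (universal_seminorm A R (x\<^sup>\<star> \<otimes> x))"
          using up[OF q xx] q_cstar[OF x] by (simp add: real_le_rsqrt)
      qed
      then show ?thesis using nonneg[OF x] nonneg[OF xx]
        by (metis abs_of_nonneg real_sqrt_abs real_sqrt_le_iff)
    qed
    ultimately show "universal_seminorm A R (x\<^sup>\<star> \<otimes> x) = (universal_seminorm A R x)\<^sup>2" by simp
  qed
qed

end

lemma star_hom_comp_seminorm: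
  assumes A: "star_algebra A" and B: "star_algebra B"
    and f: "f \<in> star_hom A B" and q: "cstar_seminorm B q"
  shows "cstar_seminorm A (\<lambda>x. q (f x))"
  using f q by (auto simp: star_hom_def cstar_seminorm_def PiE_iff star_algebra.adj_closed[OF A])

lemma cstar_algebra_seminorm: "cstar_algebra B \<Longrightarrow> cstar_seminorm B (nrm B)"
  by (simp add: cstar_seminorm_def cstar_algebra.nrm_triangle cstar_algebra.nrm_smult
      cstar_algebra.nrm_mult cstar_algebra.nrm_cstar)


subsection \<open>The free *-algebra\<close>

lemma poly_mapping_linear_induct [case_names zero single add]:
  fixes x :: "'k \<Rightarrow>\<^sub>0 'c::ab_group_add"
  assumes "P 0" "\<And>w c. P (Poly_Mapping.single w c)" "\<And>x y. P x \<Longrightarrow> P y \<Longrightarrow> P (x + y)"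
  shows "P x"
proof (induction x rule: update_induct)
  case const
  then show ?case by (rule assms)
next
  case (update f a b)
  have "Poly_Mapping.update a b f = f + Poly_Mapping.single a b"
    using update by (intro poly_mapping_eqI) (auto simp: lookup_update lookup_add lookup_single in_keys_iff when_def)
  then show ?case using assms(2,3) update by simp
qed

abbreviation scal :: "complex \<Rightarrow> ('v, 'e) free_alg \<Rightarrow> ('v, 'e) free_alg" where
  "scal c \<equiv> Poly_Mapping.map ((*) c)"

lemma lookup_scal: "Poly_Mapping.lookup (scal c x) w = c * Poly_Mapping.lookup x w"
  by transfer (simp add: when_def)

lemma scal_mult_l: "scal c x * y = scal c (x * y)"
  by (simp add: mult_map_scale_conv_mult mult.assoc)

lemma single_0_commute:
  "Poly_Mapping.single 0 (c::complex) * x = (x :: ('v, 'e) free_alg) * Poly_Mapping.single 0 c"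
  by (induction x rule: poly_mapping_linear_induct) (simp_all add: mult_single algebra_simps)

lemma scal_mult_r: "x * scal c y = scal c (x * y)"
  unfolding mult_map_scale_conv_mult
  by (simp only: mult.assoc[symmetric] single_0_commute[of c x])

lemma generator_adj_adj [simp]: "generator_adj (generator_adj g) = g"
  by (cases g) simp_all

lemma word_adj_adj [simp]: "word_adj (word_adj w) = w"
  by (simp add: word_adj_def rev_map o_def)

lemma inj_word_adj: "inj word_adj"
  by (rule inj_on_inverseI[of _ word_adj]) simp

lemma word_adj_add: "word_adj (u + w) = word_adj w + word_adj u"
  by (simp add: word_adj_def plus_word_def)

lemma lookup_free_adj:
  fixes x :: "('v, 'e) free_alg"
  shows "Poly_Mapping.lookup (free_adj x) w = cnj (Poly_Mapping.lookup x (word_adj w))"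
proof -
  have "Poly_Mapping.lookup (Poly_Mapping.map cnj y) u = cnj (Poly_Mapping.lookup y u)"
    for y :: "('v, 'e) free_alg" and u by transfer (simp add: when_def)
  moreover have "Poly_Mapping.lookup (Poly_Mapping.map_key word_adj x) w = Poly_Mapping.lookup x (word_adj w)"
    by (simp add: map_key.rep_eq[OF inj_word_adj])
  ultimately show ?thesis by (simp add: free_adj_def)
qed

lemma keys_free_adj: "Poly_Mapping.keys (free_adj x) = word_adj ` Poly_Mapping.keys x"
  by (auto simp: in_keys_iff lookup_free_adj intro!: image_eqI[of _ word_adj "word_adj _"])

lemma free_adj_single: "free_adj (Poly_Mapping.single w c) = Poly_Mapping.single (word_adj w) (cnj c)"
  by (intro poly_mapping_eqI) (auto simp: lookup_free_adj lookup_single when_def)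

lemma free_adj_add: "free_adj (x + y) = free_adj x + free_adj y"
  by (intro poly_mapping_eqI) (simp add: lookup_free_adj lookup_add)

lemma free_adj_diff: "free_adj (x - y) = free_adj x - free_adj y"
  by (intro poly_mapping_eqI) (simp add: lookup_free_adj lookup_minus)

lemma free_adj_zero: "free_adj 0 = 0"
  by (intro poly_mapping_eqI) (simp add: lookup_free_adj)

lemma free_adj_sum: "free_adj (\<Sum>i\<in>S. f i) = (\<Sum>i\<in>S. free_adj (f i))"
  by (induction S rule: infinite_finite_induct) (simp_all add: free_adj_add free_adj_zero)

lemma free_adj_adj: "free_adj (free_adj x) = x"
  by (intro poly_mapping_eqI) (simp add: lookup_free_adj)

lemma free_adj_scal: "free_adj (scal c x) = scal (cnj c) (free_adj x)"
  by (intro poly_mapping_eqI) (simp add: lookup_free_adj lookup_scal)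

lemma free_adj_mult: "free_adj (x * y) = free_adj y * free_adj x"
proof (induction x rule: poly_mapping_linear_induct)
  case (single w c)
  show ?case
    by (induction y rule: poly_mapping_linear_induct)
       (simp_all add: free_adj_zero free_adj_add distrib_left distrib_right mult_single
         free_adj_single word_adj_add mult.commute)
qed (simp_all add: free_adj_zero free_adj_add distrib_left distrib_right)

lemma free_adj_gen: "free_adj (gen g) = gen (generator_adj g)"
  by (simp add: gen_def free_adj_single word_adj_def)

definition words :: "'g set \<Rightarrow> 'g word set" where
  "words G = {w. letters w \<noteq> [] \<and> set (letters w) \<subseteq> G}"

abbreviation free_carrier :: "('v, 'e) generator set \<Rightarrow> ('v, 'e) free_alg set" where
  "free_carrier G \<equiv> {x. Poly_Mapping.keys x \<subseteq> words G}"

lemma free_simps: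
  "carrier (free_star_algebra G) = free_carrier G"
  "x \<otimes>\<^bsub>free_star_algebra G\<^esub> y = x * y"
  "x \<oplus>\<^bsub>free_star_algebra G\<^esub> y = x + y"
  "\<zero>\<^bsub>free_star_algebra G\<^esub> = 0"
  "c \<odot>\<^bsub>free_star_algebra G\<^esub> x = scal c x"
  "x\<^sup>\<star>\<^bsub>free_star_algebra G\<^esub> = free_adj x"
  by (auto simp: free_star_algebra_def words_def)

lemma free_carrier_closed:
  "0 \<in> free_carrier G"
  "x \<in> free_carrier G \<Longrightarrow> y \<in> free_carrier G \<Longrightarrow> x + y \<in> free_carrier G"
  "x \<in> free_carrier G \<Longrightarrow> y \<in> free_carrier G \<Longrightarrow> x - y \<in> free_carrier G"
  "x \<in> free_carrier G \<Longrightarrow> scal c x \<in> free_carrier G"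
  "x \<in> free_carrier G \<Longrightarrow> y \<in> free_carrier G \<Longrightarrow> x * y \<in> free_carrier G"
  "generator_adj ` G \<subseteq> G \<Longrightarrow> x \<in> free_carrier G \<Longrightarrow> free_adj x \<in> free_carrier G"
  "g \<in> G \<Longrightarrow> gen g \<in> free_carrier G"
proof -
  show "0 \<in> free_carrier G" by simp
  show "x \<in> free_carrier G \<Longrightarrow> y \<in> free_carrier G \<Longrightarrow> x + y \<in> free_carrier G"
    using keys_add[of x y] by auto
  show "x \<in> free_carrier G \<Longrightarrow> y \<in> free_carrier G \<Longrightarrow> x - y \<in> free_carrier G"
    by (auto simp: subset_iff in_keys_iff lookup_minus) metis
  show "x \<in> free_carrier G \<Longrightarrow> scal c x \<in> free_carrier G"
    by (auto simp: subset_iff in_keys_iff lookup_scal)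
  show "x \<in> free_carrier G \<Longrightarrow> y \<in> free_carrier G \<Longrightarrow> x * y \<in> free_carrier G"
    using keys_mult[of x y] by (fastforce simp: words_def plus_word_def)
  show "generator_adj ` G \<subseteq> G \<Longrightarrow> x \<in> free_carrier G \<Longrightarrow> free_adj x \<in> free_carrier G"
    by (auto simp: keys_free_adj words_def word_adj_def) blast
  show "g \<in> G \<Longrightarrow> gen g \<in> free_carrier G"
    by (simp add: gen_def words_def)
qed

lemma scal_simps:
  "scal (c + d) x = scal c x + scal d x"
  "scal c (x + y) = scal c x + scal c y"
  "scal (c * d) x = scal c (scal d x)"
  "scal 1 x = x"
  "scal (-1) x = - x"
  by (intro poly_mapping_eqI; simp add: lookup_scal lookup_add algebra_simps)+

lemma star_algebra_free:
  assumes G: "generator_adj ` G \<subseteq> G"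
  shows "star_algebra (free_star_algebra G)"
proof -
  note c = free_carrier_closed[where G = G]
  have "abelian_group (free_star_algebra G)"
  proof (rule abelian_groupI)
    fix x assume "x \<in> carrier (free_star_algebra G)"
    then show "\<exists>y\<in>carrier (free_star_algebra G).
        y \<oplus>\<^bsub>free_star_algebra G\<^esub> x = \<zero>\<^bsub>free_star_algebra G\<^esub>"
      using c(4)[of x "-1"] by (intro bexI[of _ "- x"]) (simp_all add: free_simps scal_simps)
  qed (use c(1,2) in \<open>simp_all add: free_simps add_ac\<close>)
  then show ?thesis
    by (intro star_algebra.intro star_algebra_axioms.intro)
       (use c c(6)[OF G] in \<open>simp_all add: free_simps scal_simps algebra_simps scal_mult_l scal_mult_r
         free_adj_adj free_adj_add free_adj_scal free_adj_mult\<close>)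
qed

lemma free_diff:
  assumes "generator_adj ` G \<subseteq> G" "x \<in> free_carrier G" "y \<in> free_carrier G"
  shows "x \<ominus>\<^bsub>free_star_algebra G\<^esub> y = x - y"
  using star_algebra.diff_eq[OF star_algebra_free[OF assms(1)], of x y] assms
  by (simp add: free_simps scal_simps)

lemma free_linear_induct [consumes 1, case_names zero single add]:
  assumes x: "x \<in> free_carrier G"
    and zero: "P 0"
    and single: "\<And>w c. w \<in> words G \<Longrightarrow> P (Poly_Mapping.single w c)"
    and add: "\<And>x y. x \<in> free_carrier G \<Longrightarrow> y \<in> free_carrier G \<Longrightarrow> P x \<Longrightarrow> P y \<Longrightarrow> P (x + y)"
  shows "P x"
  using x
proof (induction x rule: update_induct)
  case const
  then show ?case by (simp add: zero)
next
  case (update f a b)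
  have eq: "Poly_Mapping.update a b f = f + Poly_Mapping.single a b"
    using update by (intro poly_mapping_eqI) (auto simp: lookup_update lookup_add lookup_single in_keys_iff when_def)
  have "Poly_Mapping.keys f \<subseteq> words G" "a \<in> words G"
    using update by (auto simp: keys_update)
  then show ?case unfolding eq using update by (intro add single) auto
qed

lemma single_word_Cons:
  "l \<noteq> [] \<Longrightarrow> Poly_Mapping.single (Word (g # l)) c = gen g * Poly_Mapping.single (Word l) c"
  by (simp add: gen_def mult_single plus_word_def)

lemma free_induct [consumes 1, case_names zero gen add scal mult]:
  assumes x: "x \<in> free_carrier G"
    and zero: "P 0"
    and gen: "\<And>g. g \<in> G \<Longrightarrow> P (gen g)"
    and add: "\<And>x y. x \<in> free_carrier G \<Longrightarrow> y \<in> free_carrier G \<Longrightarrow> P x \<Longrightarrow> P y \<Longrightarrow> P (x + y)"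
    and scal: "\<And>c x. x \<in> free_carrier G \<Longrightarrow> P x \<Longrightarrow> P (scal c x)"
    and mult: "\<And>x y. x \<in> free_carrier G \<Longrightarrow> y \<in> free_carrier G \<Longrightarrow> P x \<Longrightarrow> P y \<Longrightarrow> P (x * y)"
  shows "P x"
  using x
proof (induction x rule: free_linear_induct)
  case (single w c)
  have "P (Poly_Mapping.single (Word l) c)" if "l \<noteq> []" "set l \<subseteq> G" for l
    using that
  proof (induction l)
    case (Cons g l)
    show ?case
    proof (cases "l = []")
      case True
      have "Poly_Mapping.single (Word [g]) c = scal c (gen g)"
        by (simp add: gen_def)
      then show ?thesis using True Cons gen scal free_carrier_closed(7)[of g G] by simp
    next
      case False
      have "Poly_Mapping.single (Word l) c \<in> free_carrier G"
        using False Cons by (cases "c = 0") (auto simp: words_def)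
      then show ?thesis
        unfolding single_word_Cons[OF False]
        using False Cons gen free_carrier_closed(7)[of g G] by (intro mult) auto
    qed
  qed simp
  from this[of "letters w"] single show ?case by (simp add: words_def)
qed (use zero add in auto)


subsection \<open>Extending homomorphisms to completions\<close>

sublocale cstar_algebra \<subseteq> seminormed_star_algebra A "nrm A"
  by unfold_locales (rule cstar_algebra_seminorm[OF cstar_algebra_axioms])

lemma star_homD:
  assumes "f \<in> star_hom A B"
  shows "x \<in> carrier A \<Longrightarrow> f x \<in> carrier B"
    and "x \<in> carrier A \<Longrightarrow> y \<in> carrier A \<Longrightarrow> f (x \<oplus>\<^bsub>A\<^esub> y) = f x \<oplus>\<^bsub>B\<^esub> f y"
    and "x \<in> carrier A \<Longrightarrow> f (c \<odot>\<^bsub>A\<^esub> x) = c \<odot>\<^bsub>B\<^esub> f x"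
    and "x \<in> carrier A \<Longrightarrow> y \<in> carrier A \<Longrightarrow> f (x \<otimes>\<^bsub>A\<^esub> y) = f x \<otimes>\<^bsub>B\<^esub> f y"
    and "x \<in> carrier A \<Longrightarrow> f (x\<^sup>\<star>\<^bsub>A\<^esub>) = (f x)\<^sup>\<star>\<^bsub>B\<^esub>"
  using assms by (auto simp: star_hom_def PiE_iff)

lemma star_hom_diff:
  assumes "star_algebra A" "star_algebra B" "f \<in> star_hom A B" "x \<in> carrier A" "y \<in> carrier A"
  shows "f (x \<ominus>\<^bsub>A\<^esub> y) = f x \<ominus>\<^bsub>B\<^esub> f y"
  using assms by (simp add: star_algebra.diff_eq star_algebra.smult_closed star_homD)

lemma completion_extend:
  assumes A: "seminormed_star_algebra A q" and B: "cstar_algebra B"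
    and f: "f \<in> star_hom A B" and le: "\<And>x. x \<in> carrier A \<Longrightarrow> nrm B (f x) \<le> q x"
  shows "\<exists>\<pi>\<in>star_hom (completion A q) B. \<forall>x\<in>carrier A. \<pi> (to_completion A q x) = f x"
proof -
  interpret A: seminormed_star_algebra A q by (rule A)
  interpret B: cstar_algebra B by (rule B)
  note f' = star_homD[OF f]
  have sA: "star_algebra A" and sB: "star_algebra B"
    by (rule A.star_algebra_axioms, rule B.star_algebra_axioms)
  have le_diff: "nrm B (f x \<ominus>\<^bsub>B\<^esub> f y) \<le> q (x \<ominus>\<^bsub>A\<^esub> y)" if "x \<in> carrier A" "y \<in> carrier A" for x y
    using le[of "x \<ominus>\<^bsub>A\<^esub> y"] star_hom_diff[OF sA sB f that] that by simp
  have fX: "(\<lambda>n. f (X n)) \<in> cauchy_seqs B (nrm B)" if X: "X \<in> cauchy_seqs A q" for X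
  proof (rule B.cauchyI)
    show "f (X n) \<in> carrier B" for n using X by (simp add: f' A.cauchy_carrier)
    fix e :: real assume e: "e > 0"
    obtain N where N: "\<And>m n. m \<ge> N \<Longrightarrow> n \<ge> N \<Longrightarrow> q (X m \<ominus>\<^bsub>A\<^esub> X n) < e"
      using A.cauchyD[OF X e] by auto
    have "nrm B (f (X m) \<ominus>\<^bsub>B\<^esub> f (X n)) < e" if "m \<ge> N" "n \<ge> N" for m n
      using N[OF that] le_diff[of "X m" "X n"] A.cauchy_carrier[OF X] by (meson order.strict_trans1)
    then show "\<exists>N. \<forall>m\<ge>N. \<forall>n\<ge>N. nrm B (f (X m) \<ominus>\<^bsub>B\<^esub> f (X n)) < e" by blast
  qed
  have const_inj: "b = b'" if "B.cls (\<lambda>_. b) = B.cls (\<lambda>_. b')" "b \<in> carrier B" "b' \<in> carrier B" for b b'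
  proof -
    have "(\<lambda>n::nat. nrm B (b \<ominus>\<^bsub>B\<^esub> b')) \<longlonglongrightarrow> 0"
      using that by (simp add: B.cls_eq_iff B.cauchy_const)
    then have "nrm B (b \<ominus>\<^bsub>B\<^esub> b') = 0" using LIMSEQ_unique tendsto_const by blast
    then show ?thesis using that by (simp add: B.nrm_eq_0 B.diff_eq_zeroD)
  qed
  define lm where "lm X = (SOME b. b \<in> carrier B \<and> B.cls (\<lambda>n. f (X n)) = B.cls (\<lambda>_. b))" for X
  have lm: "lm X \<in> carrier B" "B.cls (\<lambda>n. f (X n)) = B.cls (\<lambda>_. lm X)"
    if X: "X \<in> cauchy_seqs A q" for X
  proof -
    obtain b where "b \<in> carrier B" "(\<lambda>n. nrm B (f (X n) \<ominus>\<^bsub>B\<^esub> b)) \<longlonglongrightarrow> 0"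
      using B.complete[of "\<lambda>n. f (X n)"] fX[OF X] by (auto simp: cauchy_seqs_def)
    then have "b \<in> carrier B \<and> B.cls (\<lambda>n. f (X n)) = B.cls (\<lambda>_. b)"
      using fX[OF X] by (simp add: B.cls_eq_iff B.cauchy_const)
    then have "lm X \<in> carrier B \<and> B.cls (\<lambda>n. f (X n)) = B.cls (\<lambda>_. lm X)"
      unfolding lm_def by (rule someI)
    then show "lm X \<in> carrier B" "B.cls (\<lambda>n. f (X n)) = B.cls (\<lambda>_. lm X)" by auto
  qed
  have lmI: "lm X = b" if "X \<in> cauchy_seqs A q" "b \<in> carrier B" "B.cls (\<lambda>n. f (X n)) = B.cls (\<lambda>_. b)" for X b
    using const_inj[of "lm X" b] lm[OF that(1)] that by simp
  define \<pi> where "\<pi> = (\<lambda>x\<in>carrier (completion A q). lm (SOME X. X \<in> cauchy_seqs A q \<and> A.cls X = x))"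
  have \<pi>: "\<pi> (A.cls X) = lm X" if X: "X \<in> cauchy_seqs A q" for X
  proof -
    define Y where "Y = (SOME Y. Y \<in> cauchy_seqs A q \<and> A.cls Y = A.cls X)"
    have Y: "Y \<in> cauchy_seqs A q \<and> A.cls Y = A.cls X"
      unfolding Y_def by (rule someI[of _ X]) (use X in simp)
    then have "(\<lambda>n. q (Y n \<ominus>\<^bsub>A\<^esub> X n)) \<longlonglongrightarrow> 0"
      using X A.cls_eq_iff[of Y X] by simp
    then have "(\<lambda>n. nrm B (f (Y n) \<ominus>\<^bsub>B\<^esub> f (X n))) \<longlonglongrightarrow> 0"
      by (rule tendsto_sandwich[rotated 3, where f = "\<lambda>_. 0"])
         (use X Y le_diff in \<open>auto simp: A.cauchy_carrier f' B.q_nonneg intro!: always_eventually\<close>)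
    then have "B.cls (\<lambda>n. f (Y n)) = B.cls (\<lambda>n. f (X n))"
      using X Y by (simp add: B.cls_eq_iff fX)
    then have "lm Y = lm X" using X Y lm[OF X] by (intro lmI) auto
    then show ?thesis using X by (simp add: \<pi>_def Y_def A.completion_simps)
  qed
  have hom: "\<pi> \<in> star_hom (completion A q) B"
    unfolding star_hom_def
  proof (intro CollectI conjI ballI allI)
    show "\<pi> \<in> carrier (completion A q) \<rightarrow>\<^sub>E carrier B"
      using \<pi> lm by (auto simp: A.completion_simps \<pi>_def)
    fix x assume "x \<in> carrier (completion A q)"
    then obtain X where X: "X \<in> cauchy_seqs A q" "x = A.cls X" by (auto simp: A.completion_simps)
    have Xc: "X n \<in> carrier A" for n using X by (simp add: A.cauchy_carrier)
    show "\<pi> (c \<odot>\<^bsub>completion A q\<^esub> x) = c \<odot>\<^bsub>B\<^esub> \<pi> x" for c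
    proof -
      have "B.cls (\<lambda>n. f (c \<odot>\<^bsub>A\<^esub> X n)) = c \<odot>\<^bsub>completion B (nrm B)\<^esub> B.cls (\<lambda>n. f (X n))"
        using X by (simp add: B.completion_simps fX f' Xc)
      also have "\<dots> = B.cls (\<lambda>_. c \<odot>\<^bsub>B\<^esub> lm X)"
        using lm[OF X(1)] by (simp add: B.completion_simps B.cauchy_const)
      finally have "lm (\<lambda>n. c \<odot>\<^bsub>A\<^esub> X n) = c \<odot>\<^bsub>B\<^esub> lm X"
        by (intro lmI) (use X lm in \<open>simp_all add: A.cauchy_smult B.smult_closed\<close>)
      then show ?thesis using X by (simp add: A.completion_simps \<pi> A.cauchy_smult)
    qed
    show "\<pi> (x\<^sup>\<star>\<^bsub>completion A q\<^esub>) = (\<pi> x)\<^sup>\<star>\<^bsub>B\<^esub>"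
    proof -
      have "B.cls (\<lambda>n. f ((X n)\<^sup>\<star>\<^bsub>A\<^esub>)) = (B.cls (\<lambda>n. f (X n)))\<^sup>\<star>\<^bsub>completion B (nrm B)\<^esub>"
        using X by (simp add: B.completion_simps fX f' Xc)
      also have "\<dots> = B.cls (\<lambda>_. (lm X)\<^sup>\<star>\<^bsub>B\<^esub>)"
        using lm[OF X(1)] by (simp add: B.completion_simps B.cauchy_const)
      finally have "lm (\<lambda>n. (X n)\<^sup>\<star>\<^bsub>A\<^esub>) = (lm X)\<^sup>\<star>\<^bsub>B\<^esub>"
        by (intro lmI) (use X lm in \<open>simp_all add: A.cauchy_adj B.adj_closed\<close>)
      then show ?thesis using X by (simp add: A.completion_simps \<pi> A.cauchy_adj)
    qed
    fix y assume "y \<in> carrier (completion A q)"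
    then obtain Y where Y: "Y \<in> cauchy_seqs A q" "y = A.cls Y" by (auto simp: A.completion_simps)
    have Yc: "Y n \<in> carrier A" for n using Y by (simp add: A.cauchy_carrier)
    show "\<pi> (x \<oplus>\<^bsub>completion A q\<^esub> y) = \<pi> x \<oplus>\<^bsub>B\<^esub> \<pi> y"
    proof -
      have "B.cls (\<lambda>n. f (X n \<oplus>\<^bsub>A\<^esub> Y n)) =
          B.cls (\<lambda>n. f (X n)) \<oplus>\<^bsub>completion B (nrm B)\<^esub> B.cls (\<lambda>n. f (Y n))"
        using X Y by (simp add: B.completion_simps fX f' Xc Yc)
      also have "\<dots> = B.cls (\<lambda>_. lm X \<oplus>\<^bsub>B\<^esub> lm Y)"
        using lm[OF X(1)] lm[OF Y(1)] by (simp add: B.completion_simps B.cauchy_const)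
      finally have "lm (\<lambda>n. X n \<oplus>\<^bsub>A\<^esub> Y n) = lm X \<oplus>\<^bsub>B\<^esub> lm Y"
        by (intro lmI) (use X Y lm in \<open>simp_all add: A.cauchy_add B.clos\<close>)
      then show ?thesis using X Y by (simp add: A.completion_simps \<pi> A.cauchy_add)
    qed
    show "\<pi> (x \<otimes>\<^bsub>completion A q\<^esub> y) = \<pi> x \<otimes>\<^bsub>B\<^esub> \<pi> y"
    proof -
      have "B.cls (\<lambda>n. f (X n \<otimes>\<^bsub>A\<^esub> Y n)) =
          B.cls (\<lambda>n. f (X n)) \<otimes>\<^bsub>completion B (nrm B)\<^esub> B.cls (\<lambda>n. f (Y n))"
        using X Y by (simp add: B.completion_simps fX f' Xc Yc)
      also have "\<dots> = B.cls (\<lambda>_. lm X \<otimes>\<^bsub>B\<^esub> lm Y)"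
        using lm[OF X(1)] lm[OF Y(1)] by (simp add: B.completion_simps B.cauchy_const)
      finally have "lm (\<lambda>n. X n \<otimes>\<^bsub>A\<^esub> Y n) = lm X \<otimes>\<^bsub>B\<^esub> lm Y"
        by (intro lmI) (use X Y lm in \<open>simp_all add: A.cauchy_mult B.clos\<close>)
      then show ?thesis using X Y by (simp add: A.completion_simps \<pi> A.cauchy_mult)
    qed
  qed
  have "\<pi> (to_completion A q x) = f x" if "x \<in> carrier A" for x
    using that by (simp add: to_completion_def \<pi> A.cauchy_const) (auto intro!: lmI simp: A.cauchy_const f')
  with hom show ?thesis by blast
qed


subsection \<open>Evaluating the free *-algebra\<close>

fun list_val :: "('b, 'm) monoid_scheme \<Rightarrow> ('g \<Rightarrow> 'b) \<Rightarrow> 'g list \<Rightarrow> 'b" where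
  "list_val B \<gamma> [] = \<one>\<^bsub>B\<^esub>"
| "list_val B \<gamma> [g] = \<gamma> g"
| "list_val B \<gamma> (g # h # l) = \<gamma> g \<otimes>\<^bsub>B\<^esub> list_val B \<gamma> (h # l)"

definition free_eval ::
  "('b, 'm) star_alg_scheme \<Rightarrow> (('v, 'e) generator \<Rightarrow> 'b) \<Rightarrow> ('v, 'e) free_alg \<Rightarrow> 'b" where
  "free_eval B \<gamma> x = (\<Oplus>\<^bsub>B\<^esub>w\<in>Poly_Mapping.keys x. Poly_Mapping.lookup x w \<odot>\<^bsub>B\<^esub> list_val B \<gamma> (letters w))"

context star_algebra
begin

context
  fixes G :: "('v, 'e) generator set" and \<gamma> :: "('v, 'e) generator \<Rightarrow> 'a"
  assumes G: "generator_adj ` G \<subseteq> G"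
    and \<gamma>: "\<And>g. g \<in> G \<Longrightarrow> \<gamma> g \<in> carrier A"
    and \<gamma>_adj: "\<And>g. g \<in> G \<Longrightarrow> \<gamma> (generator_adj g) = (\<gamma> g)\<^sup>\<star>"
begin

lemma list_val_closed: "l \<noteq> [] \<Longrightarrow> set l \<subseteq> G \<Longrightarrow> list_val A \<gamma> l \<in> carrier A"
proof (induction l rule: induct_list012)
qed (auto simp: \<gamma> clos)

lemma list_val_append: "k \<noteq> [] \<Longrightarrow> l \<noteq> [] \<Longrightarrow> set k \<subseteq> G \<Longrightarrow> set l \<subseteq> G \<Longrightarrow>
  list_val A \<gamma> (k @ l) = list_val A \<gamma> k \<otimes> list_val A \<gamma> l"
proof (induction k)
  case (Cons g k)
  show ?case
  proof (cases k)
    case Nil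
    then show ?thesis using Cons by (cases l) auto
  next
    case (Cons h k')
    then show ?thesis using Cons.IH Cons.prems \<gamma> list_val_closed[of k] list_val_closed[of l]
      by (simp add: mult_assoc)
  qed
qed simp

lemma list_val_adj: "l \<noteq> [] \<Longrightarrow> set l \<subseteq> G \<Longrightarrow>
  list_val A \<gamma> (rev (map generator_adj l)) = (list_val A \<gamma> l)\<^sup>\<star>"
proof (induction l)
  case (Cons g l)
  show ?case
  proof (cases "l = []")
    case True
    then show ?thesis using Cons by (simp add: \<gamma>_adj)
  next
    case False
    then obtain h k where l: "l = h # k" by (cases l) auto
    have "list_val A \<gamma> (rev (map generator_adj (g # l))) =
        list_val A \<gamma> (rev (map generator_adj l) @ [generator_adj g])" by simp
    also have "\<dots> = list_val A \<gamma> (rev (map generator_adj l)) \<otimes> list_val A \<gamma> [generator_adj g]"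
      using False Cons.prems G by (intro list_val_append) auto
    also have "\<dots> = (list_val A \<gamma> l)\<^sup>\<star> \<otimes> (\<gamma> g)\<^sup>\<star>"
      using False Cons by (simp add: \<gamma>_adj)
    also have "\<dots> = (\<gamma> g \<otimes> list_val A \<gamma> l)\<^sup>\<star>"
      using False Cons.prems \<gamma> list_val_closed[of l] by (simp add: adj_mult)
    finally show ?thesis by (simp add: l)
  qed
qed simp

abbreviation "wval w \<equiv> list_val A \<gamma> (letters w)"

lemma wval_closed: "w \<in> words G \<Longrightarrow> wval w \<in> carrier A"
  by (simp add: words_def list_val_closed)

lemma free_eval_superset:
  assumes "finite S" "Poly_Mapping.keys x \<subseteq> S" "S \<subseteq> words G"
  shows "free_eval A \<gamma> x = (\<Oplus>w\<in>S. Poly_Mapping.lookup x w \<odot> wval w)"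
  unfolding free_eval_def using assms
  by (intro add.finprod_mono_neutral_cong_left)
     (auto simp: in_keys_iff zero_smult wval_closed subset_iff smult_closed)

lemma free_eval_closed: "x \<in> free_carrier G \<Longrightarrow> free_eval A \<gamma> x \<in> carrier A"
  unfolding free_eval_def by (intro finsum_closed) (auto simp: wval_closed smult_closed)

lemma free_eval_zero: "free_eval A \<gamma> 0 = \<zero>"
  by (simp add: free_eval_def)

lemma free_eval_add:
  assumes "x \<in> free_carrier G" "y \<in> free_carrier G"
  shows "free_eval A \<gamma> (x + y) = free_eval A \<gamma> x \<oplus> free_eval A \<gamma> y"
proof -
  define S where "S = Poly_Mapping.keys x \<union> Poly_Mapping.keys y"
  have S: "finite S" "S \<subseteq> words G" using assms by (auto simp: S_def)
  have "free_eval A \<gamma> (x + y) = (\<Oplus>w\<in>S. Poly_Mapping.lookup (x + y) w \<odot> wval w)"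
    by (rule free_eval_superset) (use S keys_add[of x y] in \<open>auto simp: S_def\<close>)
  also have "\<dots> = (\<Oplus>w\<in>S. Poly_Mapping.lookup x w \<odot> wval w \<oplus> Poly_Mapping.lookup y w \<odot> wval w)"
    using S by (intro finsum_cong') (auto simp: lookup_add smult_l_distr wval_closed smult_closed)
  also have "\<dots> = (\<Oplus>w\<in>S. Poly_Mapping.lookup x w \<odot> wval w) \<oplus> (\<Oplus>w\<in>S. Poly_Mapping.lookup y w \<odot> wval w)"
    using S by (intro finsum_addf) (auto simp: wval_closed smult_closed)
  also have "\<dots> = free_eval A \<gamma> x \<oplus> free_eval A \<gamma> y"
    using S by (subst (1 2) free_eval_superset[of S]) (auto simp: S_def)
  finally show ?thesis .
qed

lemma free_eval_single: "w \<in> words G \<Longrightarrow> free_eval A \<gamma> (Poly_Mapping.single w c) = c \<odot> wval w"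
  by (subst free_eval_superset[of "{w}"]) (auto simp: wval_closed smult_closed)

lemma free_eval_gen: "g \<in> G \<Longrightarrow> free_eval A \<gamma> (gen g) = \<gamma> g"
  unfolding gen_def by (subst free_eval_single) (auto simp: words_def \<gamma> smult_one)

lemma words_add: "u \<in> words G \<Longrightarrow> w \<in> words G \<Longrightarrow> u + w \<in> words G"
  by (auto simp: words_def plus_word_def)

lemma words_adj: "w \<in> words G \<Longrightarrow> word_adj w \<in> words G"
  using G by (auto simp: words_def word_adj_def)

lemma wval_add: "u \<in> words G \<Longrightarrow> w \<in> words G \<Longrightarrow> wval (u + w) = wval u \<otimes> wval w"
  by (simp add: words_def plus_word_def list_val_append)

lemma wval_adj: "w \<in> words G \<Longrightarrow> wval (word_adj w) = (wval w)\<^sup>\<star>"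
  by (simp add: words_def word_adj_def list_val_adj)

lemma single_free_carrier: "w \<in> words G \<Longrightarrow> Poly_Mapping.single w c \<in> free_carrier G"
  by simp

lemma scal_zero: "scal c 0 = 0"
  by (intro poly_mapping_eqI) (simp add: lookup_scal)

lemma free_eval_scal: "x \<in> free_carrier G \<Longrightarrow> free_eval A \<gamma> (scal c x) = c \<odot> free_eval A \<gamma> x"
proof (induction x rule: free_linear_induct)
  case (add x y)
  then show ?case
    using free_carrier_closed(4)[of x G c] free_carrier_closed(4)[of y G c] free_eval_closed[of x] free_eval_closed[of y]
    by (simp add: scal_simps free_eval_add smult_r_distr)
qed (simp_all add: free_eval_zero scal_zero smult_zero free_eval_single smult_assoc wval_closed)

lemma free_eval_adj: "x \<in> free_carrier G \<Longrightarrow> free_eval A \<gamma> (free_adj x) = (free_eval A \<gamma> x)\<^sup>\<star>"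
proof (induction x rule: free_linear_induct)
  case (add x y)
  then show ?case
    using free_carrier_closed(6)[OF G, of x] free_carrier_closed(6)[OF G, of y] free_eval_closed[of x] free_eval_closed[of y]
    by (simp add: free_adj_add free_eval_add adj_add)
qed (simp_all add: free_eval_zero adj_zero free_adj_zero free_adj_single free_eval_single words_adj wval_adj
    adj_smult wval_closed)

lemma free_eval_mult:
  assumes x: "x \<in> free_carrier G" and y: "y \<in> free_carrier G"
  shows "free_eval A \<gamma> (x * y) = free_eval A \<gamma> x \<otimes> free_eval A \<gamma> y"
  using x
proof (induction x rule: free_linear_induct)
  case zero
  then show ?case using free_eval_closed[OF y] by (simp add: free_eval_zero mult_zero_l)
next
  case (add x x')
  then show ?case
    using free_carrier_closed(5)[OF _ y, of x] free_carrier_closed(5)[OF _ y, of x'] y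
      free_eval_closed[of x] free_eval_closed[of x'] free_eval_closed[of y]
    by (simp add: distrib_right free_eval_add mult_l_distr)
next
  case (single u c)
  show ?case
    using y
  proof (induction y rule: free_linear_induct)
    case zero
    then show ?case using single by (simp add: free_eval_zero free_eval_single mult_zero_r wval_closed smult_closed)
  next
    case (single w d)
    then show ?case using \<open>u \<in> words G\<close>
      by (simp add: mult_single free_eval_single words_add wval_add wval_closed smult_mult_l smult_mult_r
          clos mult.commute[of c d] flip: smult_assoc)
  next
    case (add y y')
    then show ?case
      using free_carrier_closed(5)[OF single_free_carrier[OF single], of y c]
        free_carrier_closed(5)[OF single_free_carrier[OF single], of y' c]
        free_eval_closed[of y] free_eval_closed[of y'] free_eval_closed[OF single_free_carrier[OF single], of c]
      by (simp add: distrib_left free_eval_add mult_r_distr)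
  qed
qed

lemma free_eval_star_hom: "restrict (free_eval A \<gamma>) (free_carrier G) \<in> star_hom (free_star_algebra G) A"
  using free_carrier_closed[where G = G] G
  by (auto simp: star_hom_def free_simps free_eval_closed free_eval_add free_eval_scal free_eval_mult free_eval_adj)

end

end


subsection \<open>Leavitt path algebras and graph C*-algebras\<close>

lemma generators_adj: "generator_adj ` generators E \<subseteq> generators E"
  by (auto simp: generators_def)

lemma generators_iff [simp]:
  "Vertex v \<in> generators E \<longleftrightarrow> v \<in> verts E"
  "Edge e \<in> generators E \<longleftrightarrow> e \<in> arcs E"
  "Ghost e \<in> generators E \<longleftrightarrow> e \<in> arcs E"
  by (auto simp: generators_def)

lemma free_carrier_sum: "(\<And>i. i \<in> S \<Longrightarrow> f i \<in> free_carrier G) \<Longrightarrow> (\<Sum>i\<in>S. f i) \<in> free_carrier G"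
proof (induction S rule: infinite_finite_induct)
  case (insert i S)
  then show ?case using free_carrier_closed(2)[of "f i" G "\<Sum>i\<in>S. f i"] by auto
qed simp_all

context countable_graph
begin

abbreviation FE :: "('v, 'e) free_alg star_alg" where
  "FE \<equiv> free_star_algebra (generators E)"

abbreviation \<nu> :: "('v, 'e) free_alg \<Rightarrow> real" where
  "\<nu> \<equiv> cuntz_krieger_seminorm E"

sublocale F: star_algebra FE
  by (rule star_algebra_free[OF generators_adj])

lemma FE_diff: "x \<in> carrier FE \<Longrightarrow> y \<in> carrier FE \<Longrightarrow> x \<ominus>\<^bsub>FE\<^esub> y = x - y"
  using free_diff[OF generators_adj, of x E y] by (simp add: free_simps)

lemma FE_closed:
  "0 \<in> carrier FE"
  "x \<in> carrier FE \<Longrightarrow> y \<in> carrier FE \<Longrightarrow> x + y \<in> carrier FE"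
  "x \<in> carrier FE \<Longrightarrow> y \<in> carrier FE \<Longrightarrow> x - y \<in> carrier FE"
  "x \<in> carrier FE \<Longrightarrow> y \<in> carrier FE \<Longrightarrow> x * y \<in> carrier FE"
  "x \<in> carrier FE \<Longrightarrow> free_adj x \<in> carrier FE"
  "g \<in> generators E \<Longrightarrow> gen g \<in> carrier FE"
  "(\<And>i. i \<in> S \<Longrightarrow> f i \<in> carrier FE) \<Longrightarrow> (\<Sum>i\<in>S. f i) \<in> carrier FE"
  unfolding free_simps
  by (rule free_carrier_closed free_carrier_sum generators_adj; assumption?)+

lemma out_arcs_arcs: "e \<in> out_arcs E v \<Longrightarrow> e \<in> arcs E"
  by (simp add: out_arcs_def)

lemma leavitt_relators_carrier: "r \<in> leavitt_relators E \<Longrightarrow> r \<in> carrier FE"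
  by (cases r rule: leavitt_relators.cases)
     (auto simp: regular_vertex_def out_arcs_arcs intro!: FE_closed)

lemma cuntz_krieger_relators_carrier: "r \<in> cuntz_krieger_relators E \<Longrightarrow> r \<in> carrier FE"
  by (cases r rule: cuntz_krieger_relators.cases)
     (auto simp: regular_vertex_def out_arcs_arcs intro!: FE_closed)

lemma leavitt_relators_adj:
  assumes "r \<in> leavitt_relators E"
  shows "free_adj r \<in> leavitt_relators E"
  using assms
proof cases
  case (CK1 e f)
  have "free_adj r = gh f * ed e - (if f = e then vx (head E f) else 0)"
    using CK1 by (auto simp: free_adj_diff free_adj_mult free_adj_gen free_adj_zero)
  then show ?thesis using CK1 leavitt_relators.CK1[of f E e] by simp
next
  case (CK2 v)
  then show ?thesis
    using leavitt_relators.CK2[of E v]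
    by (simp add: free_adj_diff free_adj_sum free_adj_mult free_adj_gen)
qed (auto simp: free_adj_diff free_adj_mult free_adj_gen intro: leavitt_relators.intros)

abbreviation LI :: "('v, 'e) free_alg set" where
  "LI \<equiv> ideal_gen FE (leavitt_relators E)"

sublocale L: star_ideal FE LI
proof (unfold_locales)
  show "LI \<subseteq> carrier FE"
  proof
    fix x assume "x \<in> LI"
    then show "x \<in> carrier FE"
      by induction (auto simp: F.clos leavitt_relators_carrier)
  qed
  then have sub: "x \<in> LI \<Longrightarrow> x \<in> carrier FE" for x by blast
  show "x\<^sup>\<star>\<^bsub>FE\<^esub> \<in> LI" if "x \<in> LI" for x
    using that
  proof induction
    case (gen x)
    then show ?case using leavitt_relators_adj by (auto simp: free_simps intro: ideal_gen.gen)
  next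
    case zero
    then show ?case using ideal_gen.zero by (metis F.adj_zero)
  qed (simp_all add: F.adj_add F.adj_smult F.adj_mult sub F.adj_closed ideal_gen.intros)
qed (auto intro: ideal_gen.intros)

theorem star_algebra_leavitt_path_algebra: "star_algebra (leavitt_path_algebra E)"
  unfolding leavitt_path_algebra_def by (rule L.star_algebra_quotient)

lemma cuntz_krieger_seminorm_facts:
  assumes q: "cstar_seminorm FE q" and R: "\<forall>r\<in>cuntz_krieger_relators E. q r = 0"
  shows "v \<in> verts E \<Longrightarrow> q (vx v) \<le> 1"
    and "e \<in> arcs E \<Longrightarrow> q (ed e) \<le> 1"
    and "e \<in> arcs E \<Longrightarrow> q (gh e) \<le> 1"
    and "r \<in> leavitt_relators E \<Longrightarrow> q r = 0"
proof -
  interpret q: seminormed_star_algebra FE q by unfold_locales (rule q)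
  note c = FE_closed
  have gens: "v \<in> verts E \<Longrightarrow> vx v \<in> carrier FE" "e \<in> arcs E \<Longrightarrow> ed e \<in> carrier FE"
    "e \<in> arcs E \<Longrightarrow> gh e \<in> carrier FE" for v and e :: 'e
    by (simp_all add: c)
  have cong: "q x = q y" if "q (x - y) = 0" "x \<in> carrier FE" "y \<in> carrier FE" for x y
    using q.q_abs_diff[of x y] that by (simp add: FE_diff)
  have cstar: "q (free_adj x * x) = (q x)\<^sup>2" if "x \<in> carrier FE" for x
    using q.q_cstar[OF that] by (simp add: free_simps)
  have mult0: "q (x * y) = 0" if "q x = 0 \<or> q y = 0" "x \<in> carrier FE" "y \<in> carrier FE" for x y
    using q.q_mult[of x y] q.q_nonneg[of "x * y"] that by (auto simp: free_simps(2) c)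
  have add0: "q (x + y) = 0" if "q x = 0" "q y = 0" "x \<in> carrier FE" "y \<in> carrier FE" for x y
    using q.q_triangle[of x y] q.q_nonneg[of "x + y"] that by (auto simp: free_simps(3) c)
  have minus0: "q (x - y) = 0" if "q x = 0" "q y = 0" "x \<in> carrier FE" "y \<in> carrier FE" for x y
    using q.q_diff_triangle[of x 0 y] q.q_nonneg[of "x - y"] that q.q_diff_commute[of 0 y]
    by (auto simp: FE_diff c)
  have adj0: "q (free_adj x) = q x" if "x \<in> carrier FE" for x
    using q.q_adj[OF that] by (simp add: free_simps)
  have R': "r \<in> cuntz_krieger_relators E \<Longrightarrow> q r = 0" for r using R by blast
  note Rel = cuntz_krieger_relators.intros[THEN R']
  show v1: "q (vx v) \<le> 1" if v: "v \<in> verts E" for v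
  proof -
    have "q (vx v * vx v) = q (vx v)"
      by (rule cong) (use v Rel in \<open>auto intro!: c\<close>)
    then have "(q (vx v))\<^sup>2 = q (vx v)"
      using cstar[of "vx v"] gens v by (simp add: free_adj_gen)
    then show ?thesis by (metis mult_cancel_left2 order_refl power2_eq_square zero_le_one mult_eq_0_iff)
  qed
  show e1: "q (ed e) \<le> 1" if e: "e \<in> arcs E" for e
  proof -
    have "q (gh e * ed e) = q (vx (head E e))"
      by (rule cong) (use e Rel in \<open>auto intro!: c\<close>)
    then have "(q (ed e))\<^sup>2 \<le> 1"
      using cstar[of "ed e"] gens e v1[of "head E e"] by (simp add: free_adj_gen)
    then show ?thesis using power2_le_imp_le[of "q (ed e)" 1] by simp
  qed
  show "q (gh e) \<le> 1" if e: "e \<in> arcs E" for e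
    using e1[OF e] adj0[of "ed e"] gens e by (simp add: free_adj_gen)
  have edge_range: "q (ed e * vx (head E e) - ed e) = 0" if e: "e \<in> arcs E" for e
  proof -
    have g: "ed e \<in> carrier FE" "gh e \<in> carrier FE" "vx (head E e) \<in> carrier FE" using e gens by auto
    have "q (ed e * (gh e * ed e - vx (head E e))) = 0"
      using e Rel(5)[OF e] g by (intro mult0) (auto intro!: c)
    moreover have "q (ed e * gh e * ed e - ed e) = 0"
      by (rule Rel(3)[OF e])
    ultimately have "q ((ed e * gh e * ed e - ed e) - ed e * (gh e * ed e - vx (head E e))) = 0"
      using g by (intro minus0[of "_ - _"]) (auto intro!: c)
    then show ?thesis by (simp add: algebra_simps)
  qed
  have source_edge: "q (vx (tail E e) * ed e - ed e) = 0" if e: "e \<in> arcs E" for e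
  proof -
    define s t p :: "('v, 'e) free_alg" where "s = ed e" and "t = gh e" and "p = vx (tail E e)"
    have g: "s \<in> carrier FE" "t \<in> carrier FE" "p \<in> carrier FE"
      using e gens by (auto simp: s_def t_def p_def)
    have 1: "q ((p * (s * t) - s * t) * s) = 0"
      using Rel(6)[OF e] g
      by (intro mult0) (auto simp: s_def t_def p_def intro!: c)
    have 2: "q (s * t * s - s) = 0"
      using Rel(3)[OF e] by (simp add: s_def t_def)
    have 3: "q (p * (s * t * s - s)) = 0" using 2 g by (intro mult0) (auto intro!: c)
    have "q ((p * (s * t) - s * t) * s - p * (s * t * s - s) + (s * t * s - s)) = 0"
      using 1 2 3 g by (intro add0[of "_ - _" "_ - _"] minus0[of "(_ - _) * _" "_ * (_ - _)"]) (auto intro!: c)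
    then show ?thesis by (simp add: algebra_simps s_def t_def p_def)
  qed
  show "q r = 0" if "r \<in> leavitt_relators E" for r
    using that
  proof cases
    case (range_ghost e)
    have "free_adj (ed e * vx (head E e) - ed e) = r"
      using range_ghost by (simp add: free_adj_diff free_adj_mult free_adj_gen)
    then show ?thesis
      using adj0[of "ed e * vx (head E e) - ed e"] edge_range range_ghost gens c(3,4) head_in_verts by metis
  next
    case (ghost_source e)
    have "free_adj (vx (tail E e) * ed e - ed e) = r"
      using ghost_source by (simp add: free_adj_diff free_adj_mult free_adj_gen)
    then show ?thesis
      using adj0[of "vx (tail E e) * ed e - ed e"] source_edge ghost_source gens c(3,4) tail_in_verts by metis
  qed (auto simp: edge_range source_edge intro!: R' intro: cuntz_krieger_relators.intros)
qed

lemma cuntz_krieger_bounded: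
  assumes "x \<in> carrier FE"
  shows "\<exists>M. \<forall>q. cstar_seminorm FE q \<and> (\<forall>r\<in>cuntz_krieger_relators E. q r = 0) \<longrightarrow> q x \<le> M"
proof -
  let ?Q = "\<lambda>q. cstar_seminorm FE q \<and> (\<forall>r\<in>cuntz_krieger_relators E. q r = 0)"
  have sem: "seminormed_star_algebra FE q" if "?Q q" for q
    using that by unfold_locales blast
  from assms have "x \<in> free_carrier (generators E)" by (simp add: free_simps)
  then show ?thesis
  proof (induction x rule: free_induct)
    case zero
    have "q 0 \<le> 0" if "?Q q" for q
      using seminormed_star_algebra.q_zero[OF sem[OF that]] by (simp add: free_simps)
    then show ?case by blast
  next
    case (gen g)
    have "q (gen g) \<le> 1" if "?Q q" for q
      using gen cuntz_krieger_seminorm_facts(1-3)[of q] that by (cases g) auto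
    then show ?case by blast
  next
    case (add x y)
    then obtain M N where MN: "\<And>q. ?Q q \<Longrightarrow> q x \<le> M" "\<And>q. ?Q q \<Longrightarrow> q y \<le> N" by metis
    have "q (x + y) \<le> M + N" if "?Q q" for q
      using MN[OF that] seminormed_star_algebra.q_triangle[OF sem[OF that], of x y] add
      by (simp add: free_simps)
    then show ?case by blast
  next
    case (scal c x)
    then obtain M where M: "\<And>q. ?Q q \<Longrightarrow> q x \<le> M" by metis
    have "q (scal c x) \<le> cmod c * M" if "?Q q" for q
      using M[OF that] seminormed_star_algebra.q_smult[OF sem[OF that], of x c] scal
      by (simp add: free_simps mult_left_mono)
    then show ?case by blast
  next
    case (mult x y)
    then obtain M N where MN: "\<And>q. ?Q q \<Longrightarrow> q x \<le> M" "\<And>q. ?Q q \<Longrightarrow> q y \<le> N" by metis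
    have "q (x * y) \<le> M * N" if "?Q q" for q
    proof -
      have "q x * q y \<le> M * N"
        using MN[OF that] mult seminormed_star_algebra.q_nonneg[OF sem[OF that], of x]
          seminormed_star_algebra.q_nonneg[OF sem[OF that], of y]
        by (intro mult_mono) (auto simp: free_simps)
      then show ?thesis
        using seminormed_star_algebra.q_mult[OF sem[OF that], of x y] mult by (simp add: free_simps)
    qed
    then show ?case by blast
  qed
qed

sublocale K: seminormed_star_algebra FE \<nu>
  unfolding cuntz_krieger_seminorm_def
  by unfold_locales (rule F.cstar_seminorm_universal[OF cuntz_krieger_bounded])

lemma \<nu>_upper: "cstar_seminorm FE q \<Longrightarrow> (\<And>r. r \<in> cuntz_krieger_relators E \<Longrightarrow> q r = 0) \<Longrightarrow>
    x \<in> carrier FE \<Longrightarrow> q x \<le> \<nu> x"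
  unfolding cuntz_krieger_seminorm_def
  by (rule F.universal_seminorm_upper[OF cuntz_krieger_bounded]) auto

lemma \<nu>_relators: "r \<in> cuntz_krieger_relators E \<Longrightarrow> \<nu> r = 0"
  unfolding cuntz_krieger_seminorm_def
  by (rule F.universal_seminorm_zero[OF cuntz_krieger_bounded])

theorem cstar_algebra_graph_cstar: "cstar_algebra (graph_cstar E)"
  unfolding graph_cstar_def by (rule K.cstar_algebra_completion)

lemma \<nu>_leavitt_ideal: "x \<in> LI \<Longrightarrow> \<nu> x = 0"
proof (induction rule: ideal_gen.induct)
  case (gen x)
  then show ?case using cuntz_krieger_seminorm_facts(4)[OF K.seminorm] \<nu>_relators by blast
next
  case zero
  then show ?case by (rule K.q_zero)
next
  case (add x y)
  then show ?case
    using K.q_triangle[of x y] K.q_nonneg[of "x \<oplus>\<^bsub>FE\<^esub> y"] L.ideal_carrier[THEN subsetD]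
    by (simp add: F.clos)
next
  case (smult x c)
  then show ?case using K.q_smult[of x c] L.ideal_carrier by auto
next
  case (l_mult a x)
  then show ?case
    using K.q_mult[of a x] K.q_nonneg[of "a \<otimes>\<^bsub>FE\<^esub> x"] L.ideal_carrier[THEN subsetD]
    by (simp add: F.clos)
next
  case (r_mult a x)
  then show ?case
    using K.q_mult[of x a] K.q_nonneg[of "x \<otimes>\<^bsub>FE\<^esub> a"] L.ideal_carrier[THEN subsetD]
    by (simp add: F.clos)
qed

abbreviation emb :: "('v, 'e) free_alg \<Rightarrow> (nat \<Rightarrow> ('v, 'e) free_alg) set" where
  "emb \<equiv> to_completion FE \<nu>"

lemma emb_cong: "x \<in> carrier FE \<Longrightarrow> y \<in> carrier FE \<Longrightarrow> \<nu> (x \<ominus>\<^bsub>FE\<^esub> y) = 0 \<Longrightarrow> emb x = emb y"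
  by (simp add: to_completion_def K.cls_eq_iff K.cauchy_const)

lemma leavitt_to_cstar_coset:
  assumes x: "x \<in> carrier FE"
  shows "leavitt_to_cstar E (coset FE LI x) = emb x"
proof -
  have "emb x' = emb x" if "x' \<in> coset FE LI x" for x'
    using that x \<nu>_leavitt_ideal by (intro emb_cong) (auto simp: L.mem_coset_iff)
  then have "(\<Union>x'\<in>coset FE LI x. emb x') = emb x" using L.coset_self[OF x] by blast
  then show ?thesis using x
    by (simp add: leavitt_to_cstar_def leavitt_path_algebra_def L.quotient_carrier)
qed

theorem leavitt_to_cstar_star_hom:
  "leavitt_to_cstar E \<in> star_hom (leavitt_path_algebra E) (graph_cstar E)"
proof -
  note e = star_homD[OF K.to_completion_star_hom, folded graph_cstar_def]
  note qs = L.quotient_carrier L.quotient_add L.quotient_smult L.quotient_mult L.quotient_adj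
  note D = L.quotient_carrier[THEN eqset_imp_iff, THEN iffD1, THEN imageE]
  have ext: "leavitt_to_cstar E \<in> extensional (carrier (leavitt_path_algebra E))"
    by (simp add: leavitt_to_cstar_def)
  show ?thesis
    using ext e unfolding star_hom_def PiE_def leavitt_path_algebra_def
    by (auto elim!: D simp: qs leavitt_to_cstar_coset F.clos Pi_iff)
qed

theorem leavitt_to_cstar_generator:
  "g \<in> generators E \<Longrightarrow> leavitt_to_cstar E (leavitt_generator E g) = cstar_generator E g"
  unfolding leavitt_generator_def cstar_generator_def
  by (rule leavitt_to_cstar_coset) (rule FE_closed)

theorem leavitt_to_cstar_dense:
  assumes "x \<in> carrier (graph_cstar E)" "e > 0"
  shows "\<exists>a\<in>carrier (leavitt_path_algebra E).
    nrm (graph_cstar E) (x \<ominus>\<^bsub>graph_cstar E\<^esub> leavitt_to_cstar E a) < e"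
proof -
  obtain b where b: "b \<in> carrier FE" "nrm (graph_cstar E) (x \<ominus>\<^bsub>graph_cstar E\<^esub> emb b) < e"
    using K.completion_dense assms unfolding graph_cstar_def by blast
  then show ?thesis
    by (intro bexI[of _ "coset FE LI b"])
       (simp_all add: leavitt_to_cstar_coset leavitt_path_algebra_def L.quotient_carrier)
qed

end

definition cuntz_krieger_family ::
  "('v, 'e) pre_digraph \<Rightarrow> ('b, 'm) star_alg_scheme \<Rightarrow> ('v \<Rightarrow> 'b) \<Rightarrow> ('e \<Rightarrow> 'b) \<Rightarrow> bool" where
  "cuntz_krieger_family E B P S \<longleftrightarrow>
     (\<forall>v\<in>verts E. P v \<in> carrier B \<and> (P v)\<^sup>\<star>\<^bsub>B\<^esub> = P v \<and> P v \<otimes>\<^bsub>B\<^esub> P v = P v) \<and>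
     (\<forall>v\<in>verts E. \<forall>w\<in>verts E. v \<noteq> w \<longrightarrow> P v \<otimes>\<^bsub>B\<^esub> P w = \<zero>\<^bsub>B\<^esub>) \<and>
     (\<forall>e\<in>arcs E. S e \<in> carrier B \<and> S e \<otimes>\<^bsub>B\<^esub> (S e)\<^sup>\<star>\<^bsub>B\<^esub> \<otimes>\<^bsub>B\<^esub> S e = S e) \<and>
     (\<forall>e\<in>arcs E. \<forall>f\<in>arcs E. e \<noteq> f \<longrightarrow> (S e)\<^sup>\<star>\<^bsub>B\<^esub> \<otimes>\<^bsub>B\<^esub> S f = \<zero>\<^bsub>B\<^esub>) \<and>
     (\<forall>e\<in>arcs E. (S e)\<^sup>\<star>\<^bsub>B\<^esub> \<otimes>\<^bsub>B\<^esub> S e = P (head E e)) \<and>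
     (\<forall>e\<in>arcs E. P (tail E e) \<otimes>\<^bsub>B\<^esub> (S e \<otimes>\<^bsub>B\<^esub> (S e)\<^sup>\<star>\<^bsub>B\<^esub>) = S e \<otimes>\<^bsub>B\<^esub> (S e)\<^sup>\<star>\<^bsub>B\<^esub>) \<and>
     (\<forall>v. regular_vertex E v \<longrightarrow> P v = (\<Oplus>\<^bsub>B\<^esub>e\<in>out_arcs E v. S e \<otimes>\<^bsub>B\<^esub> (S e)\<^sup>\<star>\<^bsub>B\<^esub>))"

context countable_graph
begin

lemma hom_sum:
  assumes B: "star_algebra B" and f: "f \<in> star_hom FE B"
    and "finite S" "\<And>i. i \<in> S \<Longrightarrow> t i \<in> carrier FE"
  shows "f (\<Sum>i\<in>S. t i) = (\<Oplus>\<^bsub>B\<^esub>i\<in>S. f (t i))"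
  using assms(3,4)
proof (induction S rule: finite_induct)
  case empty
  interpret B: star_algebra B by (rule B)
  have "f (0 + 0) = f 0 \<oplus>\<^bsub>B\<^esub> f 0" "f 0 \<in> carrier B"
    using star_homD(2)[OF f FE_closed(1) FE_closed(1)] star_homD(1)[OF f FE_closed(1)]
    by (simp_all only: free_simps)
  then have "f 0 = \<zero>\<^bsub>B\<^esub>" by (intro B.add_eq_selfD) simp_all
  then show ?case by simp
next
  case (insert i S)
  interpret B: star_algebra B by (rule B)
  have "f (\<Sum>i\<in>insert i S. t i) = f (t i \<oplus>\<^bsub>FE\<^esub> (\<Sum>i\<in>S. t i))"
    using insert.hyps by (simp add: free_simps(3))
  also have "\<dots> = f (t i) \<oplus>\<^bsub>B\<^esub> f (\<Sum>i\<in>S. t i)"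
    by (intro star_homD(2)[OF f] FE_closed(7) insert.prems) auto
  also have "\<dots> = (\<Oplus>\<^bsub>B\<^esub>i\<in>insert i S. f (t i))"
  proof -
    have "f (t j) \<in> carrier B" if "j \<in> insert i S" for j
      by (rule star_homD(1)[OF f insert.prems[OF that]])
    then show ?thesis using insert.hyps insert.IH insert.prems by (simp add: Pi_iff)
  qed
  finally show ?case .
qed

theorem graph_cstar_family:
  "cuntz_krieger_family E (graph_cstar E)
     (\<lambda>v. cstar_generator E (Vertex v)) (\<lambda>e. cstar_generator E (Edge e))"
proof -
  interpret A: cstar_algebra "graph_cstar E" by (rule cstar_algebra_graph_cstar)
  note hom = K.to_completion_star_hom[folded graph_cstar_def]
  note e = star_homD[OF hom]
  note c = FE_closed
  have gens: "v \<in> verts E \<Longrightarrow> vx v \<in> carrier FE" "e \<in> arcs E \<Longrightarrow> ed e \<in> carrier FE"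
    "e \<in> arcs E \<Longrightarrow> gh e \<in> carrier FE" for v and e :: 'e
    by (simp_all add: c)
  have mult: "emb x \<otimes>\<^bsub>graph_cstar E\<^esub> emb y = emb (x * y)" if "x \<in> carrier FE" "y \<in> carrier FE" for x y
    using e(4)[of x y] that by (simp add: free_simps(2) c)
  have adj: "(emb x)\<^sup>\<star>\<^bsub>graph_cstar E\<^esub> = emb (free_adj x)" if "x \<in> carrier FE" for x
    using e(5)[of x] that by (simp add: free_simps(6) c)
  have zero: "\<zero>\<^bsub>graph_cstar E\<^esub> = emb 0"
    by (simp add: graph_cstar_def K.completion_simps to_completion_def free_simps)
  have cong: "emb x = emb y" if "x - y \<in> cuntz_krieger_relators E" "x \<in> carrier FE" "y \<in> carrier FE" for x y
    using that \<nu>_relators by (intro emb_cong) (auto simp: FE_diff)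
  have cl: "emb x \<in> carrier (graph_cstar E)" if "x \<in> carrier FE" for x using e(1)[of x] that by simp
  have sum: "(\<Oplus>\<^bsub>graph_cstar E\<^esub>i\<in>S. emb (t i)) = emb (\<Sum>i\<in>S. t i)"
    if "finite S" "\<And>i. i \<in> S \<Longrightarrow> t i \<in> carrier FE" for S and t :: "'e \<Rightarrow> _"
  proof -
    have "(\<Oplus>\<^bsub>graph_cstar E\<^esub>i\<in>S. emb (t i)) = (\<Oplus>\<^bsub>graph_cstar E\<^esub>i\<in>S. restrict emb (carrier FE) (t i))"
      using that by (intro A.finsum_cong') (auto simp: cl)
    also have "\<dots> = restrict emb (carrier FE) (\<Sum>i\<in>S. t i)"
      using hom_sum[OF A.star_algebra_axioms hom that] by simp
    finally show ?thesis using that c(7)[of S t] by simp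
  qed
  show ?thesis
    unfolding cuntz_krieger_family_def cstar_generator_def
  proof (intro conjI ballI allI impI)
    fix v w assume v: "v \<in> verts E"
    show "emb (vx v) \<in> carrier (graph_cstar E)" by (rule cl[OF gens(1)[OF v]])
    show "(emb (vx v))\<^sup>\<star>\<^bsub>graph_cstar E\<^esub> = emb (vx v)" using v by (simp add: adj gens free_adj_gen)
    show "emb (vx v) \<otimes>\<^bsub>graph_cstar E\<^esub> emb (vx v) = emb (vx v)"
      using v by (simp add: mult gens) (intro cong; simp add: c gens cuntz_krieger_relators.projection)
    assume w: "w \<in> verts E" "v \<noteq> w"
    show "emb (vx v) \<otimes>\<^bsub>graph_cstar E\<^esub> emb (vx w) = \<zero>\<^bsub>graph_cstar E\<^esub>"
      using v w by (simp add: mult gens zero) (intro cong; simp add: c gens cuntz_krieger_relators.orthogonal)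
  next
    fix a assume a: "a \<in> arcs E"
    show "emb (ed a) \<in> carrier (graph_cstar E)" by (rule cl[OF gens(2)[OF a]])
    show "emb (ed a) \<otimes>\<^bsub>graph_cstar E\<^esub> (emb (ed a))\<^sup>\<star>\<^bsub>graph_cstar E\<^esub> \<otimes>\<^bsub>graph_cstar E\<^esub> emb (ed a) = emb (ed a)"
      using a by (simp add: mult adj gens free_adj_gen c)
        (intro cong; simp add: c gens cuntz_krieger_relators.partial_isometry)
    show "(emb (ed a))\<^sup>\<star>\<^bsub>graph_cstar E\<^esub> \<otimes>\<^bsub>graph_cstar E\<^esub> emb (ed a) = emb (vx (head E a))"
      using a by (simp add: mult adj gens free_adj_gen c)
        (intro cong; simp add: c gens cuntz_krieger_relators.initial_projection)
    show "emb (vx (tail E a)) \<otimes>\<^bsub>graph_cstar E\<^esub> (emb (ed a) \<otimes>\<^bsub>graph_cstar E\<^esub> (emb (ed a))\<^sup>\<star>\<^bsub>graph_cstar E\<^esub>) =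
        emb (ed a) \<otimes>\<^bsub>graph_cstar E\<^esub> (emb (ed a))\<^sup>\<star>\<^bsub>graph_cstar E\<^esub>"
      using a by (simp add: mult adj gens free_adj_gen c)
        (intro cong; simp add: c gens cuntz_krieger_relators.range_le)
    fix b assume b: "b \<in> arcs E" "a \<noteq> b"
    show "(emb (ed a))\<^sup>\<star>\<^bsub>graph_cstar E\<^esub> \<otimes>\<^bsub>graph_cstar E\<^esub> emb (ed b) = \<zero>\<^bsub>graph_cstar E\<^esub>"
      using a b by (simp add: mult adj gens free_adj_gen c zero)
        (intro cong; simp add: c gens cuntz_krieger_relators.orthogonal_ranges)
  next
    fix v assume v: "regular_vertex E v"
    have arcs: "a \<in> out_arcs E v \<Longrightarrow> a \<in> arcs E" for a by (rule out_arcs_arcs)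
    have "(\<Oplus>\<^bsub>graph_cstar E\<^esub>a\<in>out_arcs E v. emb (ed a) \<otimes>\<^bsub>graph_cstar E\<^esub> (emb (ed a))\<^sup>\<star>\<^bsub>graph_cstar E\<^esub>) =
        (\<Oplus>\<^bsub>graph_cstar E\<^esub>a\<in>out_arcs E v. emb (ed a * gh a))"
      by (intro A.finsum_cong') (auto simp: mult adj gens free_adj_gen arcs cl c)
    also have "\<dots> = emb (\<Sum>a\<in>out_arcs E v. ed a * gh a)"
      using v by (intro sum) (auto simp: regular_vertex_def gens arcs c)
    also have "\<dots> = emb (vx v)"
      by (rule cong[symmetric])
         (use v in \<open>auto simp: regular_vertex_def gens arcs cuntz_krieger_relators.range_sum intro!: c\<close>)
    finally show "emb (vx v) = (\<Oplus>\<^bsub>graph_cstar E\<^esub>a\<in>out_arcs E v.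
        emb (ed a) \<otimes>\<^bsub>graph_cstar E\<^esub> (emb (ed a))\<^sup>\<star>\<^bsub>graph_cstar E\<^esub>)" by simp
  qed
qed

text \<open>The universal property, for C*-algebras \<open>B\<close> over an arbitrary type.\<close>

theorem graph_cstar_universal:
  assumes B: "cstar_algebra B" and fam: "cuntz_krieger_family E B P S"
  shows "\<exists>\<pi>\<in>star_hom (graph_cstar E) B.
    (\<forall>v\<in>verts E. \<pi> (cstar_generator E (Vertex v)) = P v) \<and>
    (\<forall>e\<in>arcs E. \<pi> (cstar_generator E (Edge e)) = S e)"
proof -
  interpret B: cstar_algebra B by (rule B)
  define \<gamma> where "\<gamma> g = (case g of Vertex v \<Rightarrow> P v | Edge e \<Rightarrow> S e | Ghost e \<Rightarrow> (S e)\<^sup>\<star>\<^bsub>B\<^esub>)" for g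
  have fam': "v \<in> verts E \<Longrightarrow> P v \<in> carrier B" "v \<in> verts E \<Longrightarrow> (P v)\<^sup>\<star>\<^bsub>B\<^esub> = P v"
    "v \<in> verts E \<Longrightarrow> P v \<otimes>\<^bsub>B\<^esub> P v = P v"
    "v \<in> verts E \<Longrightarrow> w \<in> verts E \<Longrightarrow> v \<noteq> w \<Longrightarrow> P v \<otimes>\<^bsub>B\<^esub> P w = \<zero>\<^bsub>B\<^esub>"
    "e \<in> arcs E \<Longrightarrow> S e \<in> carrier B"
    "e \<in> arcs E \<Longrightarrow> S e \<otimes>\<^bsub>B\<^esub> (S e)\<^sup>\<star>\<^bsub>B\<^esub> \<otimes>\<^bsub>B\<^esub> S e = S e"
    "e \<in> arcs E \<Longrightarrow> f \<in> arcs E \<Longrightarrow> e \<noteq> f \<Longrightarrow> (S e)\<^sup>\<star>\<^bsub>B\<^esub> \<otimes>\<^bsub>B\<^esub> S f = \<zero>\<^bsub>B\<^esub>"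
    "e \<in> arcs E \<Longrightarrow> (S e)\<^sup>\<star>\<^bsub>B\<^esub> \<otimes>\<^bsub>B\<^esub> S e = P (head E e)"
    "e \<in> arcs E \<Longrightarrow> P (tail E e) \<otimes>\<^bsub>B\<^esub> (S e \<otimes>\<^bsub>B\<^esub> (S e)\<^sup>\<star>\<^bsub>B\<^esub>) = S e \<otimes>\<^bsub>B\<^esub> (S e)\<^sup>\<star>\<^bsub>B\<^esub>"
    "regular_vertex E v \<Longrightarrow> P v = (\<Oplus>\<^bsub>B\<^esub>e\<in>out_arcs E v. S e \<otimes>\<^bsub>B\<^esub> (S e)\<^sup>\<star>\<^bsub>B\<^esub>)" for v w e f
    using fam unfolding cuntz_krieger_family_def by blast+
  have \<gamma>: "g \<in> generators E \<Longrightarrow> \<gamma> g \<in> carrier B" for g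
    by (cases g) (auto simp: \<gamma>_def fam' B.adj_closed)
  have \<gamma>_adj: "g \<in> generators E \<Longrightarrow> \<gamma> (generator_adj g) = (\<gamma> g)\<^sup>\<star>\<^bsub>B\<^esub>" for g
    by (cases g) (auto simp: \<gamma>_def fam' B.adj_adj)
  define f where "f = restrict (free_eval B \<gamma>) (free_carrier (generators E))"
  have hom: "f \<in> star_hom FE B"
    unfolding f_def by (rule B.free_eval_star_hom[where \<gamma> = \<gamma>, OF generators_adj \<gamma> \<gamma>_adj])
  have gen: "f (gen g) = \<gamma> g" if "g \<in> generators E" for g
    using that B.free_eval_gen[where G = "generators E" and \<gamma> = \<gamma>, OF generators_adj \<gamma> \<gamma>_adj that]
      free_carrier_closed(7)[OF that] by (simp add: f_def)
  note h = star_homD[OF hom]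
  note c = FE_closed
  have gens: "v \<in> verts E \<Longrightarrow> vx v \<in> carrier FE" "e \<in> arcs E \<Longrightarrow> ed e \<in> carrier FE"
    "e \<in> arcs E \<Longrightarrow> gh e \<in> carrier FE" for v and e :: 'e
    by (simp_all add: c)
  have fg: "v \<in> verts E \<Longrightarrow> f (vx v) = P v" "e \<in> arcs E \<Longrightarrow> f (ed e) = S e"
    "e \<in> arcs E \<Longrightarrow> f (gh e) = (S e)\<^sup>\<star>\<^bsub>B\<^esub>" for v and e :: 'e
    by (simp_all add: gen \<gamma>_def)
  have fmult: "f (x * y) = f x \<otimes>\<^bsub>B\<^esub> f y" if "x \<in> carrier FE" "y \<in> carrier FE" for x y
    using h(4)[OF that] by (simp add: free_simps)
  have fdiff: "f (x - y) = \<zero>\<^bsub>B\<^esub>" if "x \<in> carrier FE" "y \<in> carrier FE" "f x = f y" for x y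
    using star_hom_diff[OF F.star_algebra_axioms B.star_algebra_axioms hom that(1,2)] that h(1)
    by (simp add: FE_diff B.diff_self)
  have rel: "f r = \<zero>\<^bsub>B\<^esub>" if "r \<in> cuntz_krieger_relators E" for r
    using that
  proof cases
    case (range_sum v)
    have arcs: "a \<in> out_arcs E v \<Longrightarrow> a \<in> arcs E" for a by (rule out_arcs_arcs)
    have "f (\<Sum>e\<in>out_arcs E v. ed e * gh e) = (\<Oplus>\<^bsub>B\<^esub>e\<in>out_arcs E v. f (ed e * gh e))"
      using range_sum by (intro hom_sum[OF B.star_algebra_axioms hom])
        (auto simp: regular_vertex_def gens arcs c)
    also have "\<dots> = (\<Oplus>\<^bsub>B\<^esub>e\<in>out_arcs E v. S e \<otimes>\<^bsub>B\<^esub> (S e)\<^sup>\<star>\<^bsub>B\<^esub>)"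
      by (intro B.finsum_cong') (auto simp: fmult fg gens arcs fam' B.clos)
    finally have "f (vx v) = f (\<Sum>e\<in>out_arcs E v. ed e * gh e)"
      using range_sum fam'(10)[of v] by (simp add: fg regular_vertex_def)
    then show ?thesis
      unfolding range_sum(1) using range_sum(2)
      by (intro fdiff) (auto simp: regular_vertex_def gens arcs intro!: c)
  next
    case (partial_isometry e)
    then show ?thesis by (auto intro!: fdiff c simp: fmult fg gens fam' c)
  next
    case (range_le e)
    then show ?thesis by (auto intro!: fdiff c simp: fmult fg gens fam' c)
  qed (auto intro!: fdiff c simp: fmult fg gens fam')
  have "nrm B (f x) \<le> \<nu> x" if "x \<in> carrier FE" for x
    using that
    by (intro \<nu>_upper[where q = "\<lambda>x. nrm B (f x)"] star_hom_comp_seminorm[OF _ _ hom]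
        B.seminorm F.star_algebra_axioms B.star_algebra_axioms) (simp_all add: rel B.q_zero)
  then obtain \<pi> where \<pi>: "\<pi> \<in> star_hom (graph_cstar E) B" "\<And>x. x \<in> carrier FE \<Longrightarrow> \<pi> (emb x) = f x"
    using completion_extend[OF K.seminormed_star_algebra_axioms B hom] unfolding graph_cstar_def by blast
  then show ?thesis
    by (intro bexI[of _ \<pi>]) (auto simp: cstar_generator_def gens fg)
qed

end

end

theory Submission
  imports Defs
begin

text \<open>
  The Cuntz--Krieger relators lie in the ideal generated by the Leavitt relators, so
  \<open>\<iota>\<^sub>F \<circ> \<phi>\<close> gives a C*-seminorm on the free algebra that vanishes on them and is therefore bounded
  by the universal one; hence it extends to \<open>C\<^sup>*(E)\<close>. Uniqueness is required among all algebraic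
  *-homomorphisms, so it rests on their automatic continuity: every C*-seminorm on a C*-algebra
  is bounded by the norm. An isomorphism is inverted by the extension of \<open>\<phi>\<close>'s inverse.
\<close>

section \<open>Automatic continuity: C*-seminorms on a C*-algebra\<close>

context cstar_algebra
begin

lemma limit_unique:
  assumes "\<And>n. X n \<in> carrier A" "x \<in> carrier A" "y \<in> carrier A"
    and "(\<lambda>n. nrm A (X n \<ominus> x)) \<longlonglongrightarrow> 0" "(\<lambda>n. nrm A (X n \<ominus> y)) \<longlonglongrightarrow> 0"
  shows "x = y"
proof -
  have "(\<lambda>n. nrm A (X n \<ominus> x) + nrm A (X n \<ominus> y)) \<longlonglongrightarrow> 0 + 0"
    using assms(4,5) by (rule tendsto_add)
  moreover have "nrm A (x \<ominus> y) \<le> nrm A (X n \<ominus> x) + nrm A (X n \<ominus> y)" for n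
    using q_diff_triangle[of x "X n" y] q_diff_commute[of x "X n"] assms(1-3) by simp
  ultimately have "nrm A (x \<ominus> y) \<le> 0"
    by (intro LIMSEQ_le_const) auto
  then have "nrm A (x \<ominus> y) = 0"
    using q_nonneg[of "x \<ominus> y"] assms(2,3) by simp
  then show ?thesis
    using nrm_eq_0[of "x \<ominus> y"] diff_eq_zeroD assms(2,3) by simp
qed

text \<open>Noncommutative form of x^2 - y^2 = x(x - y) + (x - y)y. It makes the iteration
  \<open>f\<close> of the next proof a contraction on balls of radius less than 1.\<close>

lemma square_diff_le:
  assumes "x \<in> carrier A" "y \<in> carrier A"
  shows "nrm A (x \<otimes> x \<ominus> y \<otimes> y) \<le> (nrm A x + nrm A y) * nrm A (x \<ominus> y)"
proof -
  have "x \<otimes> x \<ominus> y \<otimes> y = x \<otimes> (x \<ominus> y) \<oplus> (x \<ominus> y) \<otimes> y"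
    using assms by (simp add: mult_diff_l mult_diff_r clos diff_diff_trans)
  then have "nrm A (x \<otimes> x \<ominus> y \<otimes> y) \<le> nrm A (x \<otimes> (x \<ominus> y)) + nrm A ((x \<ominus> y) \<otimes> y)"
    using assms by (simp add: nrm_triangle clos)
  also have "\<dots> \<le> nrm A x * nrm A (x \<ominus> y) + nrm A (x \<ominus> y) * nrm A y"
    using assms by (intro add_mono nrm_mult) (simp_all add: clos)
  finally show ?thesis by (simp add: algebra_simps)
qed

text \<open>The element \<open>k\<close> stands for \<open>1 - sqrt (1 - a)\<close>, which makes sense without a unit.\<close>

lemma one_minus_sqrt_exists:
  assumes a: "a \<in> carrier A" "a\<^sup>\<star> = a" "nrm A a < 1"
  obtains k where "k \<in> carrier A" "k\<^sup>\<star> = k" "k \<oplus> k = a \<oplus> k \<otimes> k"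
    "\<And>b. b \<in> carrier A \<Longrightarrow> a \<otimes> b = b \<otimes> a \<Longrightarrow> k \<otimes> b = b \<otimes> k"
proof -
  \<comment> \<open>\<open>t\<close> is the smaller root of T^2 - 2T + \<open>nrm A a\<close> = 0,
    so \<open>f\<close> maps the closed ball of radius \<open>t\<close> into itself and, since
    \<open>t < 1\<close>, contracts it by the factor \<open>t\<close>.\<close>
  define t where "t = 1 - sqrt (1 - nrm A a)"
  have t: "0 \<le> t" "t < 1" "nrm A a + t\<^sup>2 = 2 * t"
    using a q_nonneg[OF a(1)] by (simp_all add: t_def power2_eq_square algebra_simps)
  \<comment> \<open>A fixed point \<open>k\<close> of \<open>f\<close> solves 2k = a + k^2, which
    formally says (1 - k)^2 = 1 - a.\<close>
  define f where "f x = (1/2) \<odot> (a \<oplus> x \<otimes> x)" for x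
  have f_closed: "f x \<in> carrier A" if "x \<in> carrier A" for x
    using that a by (simp add: f_def clos)
  have f_lip: "nrm A (f x \<ominus> f y) \<le> (nrm A x + nrm A y) / 2 * nrm A (x \<ominus> y)"
    if "x \<in> carrier A" "y \<in> carrier A" for x y
  proof -
    have "f x \<ominus> f y = (1/2) \<odot> (x \<otimes> x \<ominus> y \<otimes> y)"
      using that a by (simp add: f_def clos add_diff_add diff_self flip: smult_diff)
    then show ?thesis using square_diff_le[OF that] that by (simp add: nrm_smult clos)
  qed
  \<comment> \<open>Starting at zero makes every iterate a polynomial in \<open>a\<close> with real
    coefficients and no constant term; self-adjointness and commutation with the commutant of
    \<open>a\<close> then pass to the limit.\<close>
  define K where "K n = (f ^^ n) \<zero>" for n
  have K_Suc: "K (Suc n) = f (K n)" for n by (simp add: K_def)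
  have Kc: "K n \<in> carrier A" for n by (induction n) (simp_all add: K_def f_closed)
  have Kadj: "(K n)\<^sup>\<star> = K n" for n
  proof (induction n)
    case 0
    then show ?case by (simp add: K_def adj_zero)
  next
    case (Suc n)
    then show ?case using a Kc[of n] by (simp add: K_Suc f_def clos adj_smult adj_add adj_mult)
  qed
  have Kt: "nrm A (K n) \<le> t" for n
  proof (induction n)
    case 0
    then show ?case using t by (simp add: K_def q_zero)
  next
    case (Suc n)
    have "nrm A (K n \<otimes> K n) \<le> t * t"
      using nrm_mult[OF Kc Kc, of n n] mult_mono[OF Suc Suc] q_nonneg[OF Kc, of n] t(1) by simp
    then show ?case
      using nrm_triangle[of a "K n \<otimes> K n"] Kc[of n] a t(3)
      by (simp add: K_Suc f_def clos nrm_smult power2_eq_square)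
  qed
  have Kcomm: "K n \<otimes> b = b \<otimes> K n" if "b \<in> carrier A" "a \<otimes> b = b \<otimes> a" for n b
  proof (induction n)
    case 0
    then show ?case using that by (simp add: K_def mult_zero_l mult_zero_r)
  next
    case (Suc n)
    have "K n \<otimes> K n \<otimes> b = b \<otimes> (K n \<otimes> K n)"
      using Suc Kc[of n] that(1) by (metis mult_assoc)
    then show ?case
      using a that Kc[of n]
      by (simp add: K_Suc f_def clos smult_mult_l smult_mult_r mult_l_distr mult_r_distr)
  qed
  \<comment> \<open>The induction starts from \<open>Kt\<close>, as \<open>t < 1 = t ^ 0\<close>;
    each further application of \<open>f\<close> gains a factor \<open>t\<close>.\<close>
  have Kdist: "nrm A (K (n + m) \<ominus> K n) \<le> t ^ n" for m n
  proof (induction n)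
    case 0
    then show ?case using Kt[of m] Kc[of m] t by (simp add: K_def diff_zero)
  next
    case (Suc n)
    have "nrm A (K (Suc n + m) \<ominus> K (Suc n)) \<le>
        (nrm A (K (n + m)) + nrm A (K n)) / 2 * nrm A (K (n + m) \<ominus> K n)"
      using f_lip[OF Kc Kc] by (simp add: K_Suc)
    also have "\<dots> \<le> t * t ^ n"
      using Kt[of "n + m"] Kt[of n] t Kc Suc by (intro mult_mono) (simp_all add: q_nonneg)
    finally show ?case by simp
  qed
  have "\<exists>N. \<forall>m\<ge>N. \<forall>n\<ge>N. nrm A (K m \<ominus> K n) < e" if "e > 0" for e
  proof -
    obtain N where N: "t ^ N < e / 2"
      using real_arch_pow_inv[of "e/2" t] \<open>e > 0\<close> t by auto
    have "nrm A (K m \<ominus> K n) < e" if "m \<ge> N" "n \<ge> N" for m n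
      using q_diff_triangle[OF Kc[of m] Kc[of N] Kc[of n]] Kdist[of N "m - N"] Kdist[of N "n - N"]
        q_diff_commute[OF Kc[of N] Kc[of n]] that N by simp
    then show ?thesis by blast
  qed
  from complete[of K, OF Kc this] obtain k where
    k: "k \<in> carrier A" and lim: "(\<lambda>n. nrm A (K n \<ominus> k)) \<longlonglongrightarrow> 0" by blast
  have squeeze: "(\<lambda>n. nrm A (X n)) \<longlonglongrightarrow> 0"
    if "\<And>n. X n \<in> carrier A" "\<And>n. nrm A (X n) \<le> C * nrm A (K n \<ominus> k)" for X C
  proof (rule tendsto_sandwich[of "\<lambda>_. 0"])
    show "(\<lambda>n. C * nrm A (K n \<ominus> k)) \<longlonglongrightarrow> 0" using tendsto_mult_left[OF lim, of C] by simp
  qed (use that q_nonneg in \<open>auto intro!: always_eventually\<close>)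
  have "f k = k"
  proof (rule limit_unique[of "\<lambda>n. K (Suc n)"])
    show "(\<lambda>n. nrm A (K (Suc n) \<ominus> k)) \<longlonglongrightarrow> 0" using lim by (rule LIMSEQ_Suc)
    show "(\<lambda>n. nrm A (K (Suc n) \<ominus> f k)) \<longlonglongrightarrow> 0"
    proof (rule squeeze)
      fix n
      \<comment> \<open>A crude Lipschitz constant suffices here, so the norm of the limit
        \<open>k\<close> need not be estimated.\<close>
      have "(nrm A (K n) + nrm A k) / 2 * nrm A (K n \<ominus> k) \<le> (1 + nrm A k) * nrm A (K n \<ominus> k)"
        using Kt[of n] t q_nonneg[OF k] k Kc[of n] by (intro mult_right_mono) (simp add: field_simps, simp add: q_nonneg)
      then show "nrm A (K (Suc n) \<ominus> f k) \<le> (1 + nrm A k) * nrm A (K n \<ominus> k)"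
        using f_lip[OF Kc k, of n] by (simp add: K_Suc)
    qed (simp add: Kc f_closed k)
  qed (simp_all add: Kc f_closed k)
  then have "2 \<odot> k = 2 \<odot> ((1/2) \<odot> (a \<oplus> k \<otimes> k))" by (simp add: f_def)
  also have "\<dots> = a \<oplus> k \<otimes> k"
    using a k smult_assoc[of "a \<oplus> k \<otimes> k" 2 "1/2"] by (simp add: clos smult_one)
  finally have k2: "k \<oplus> k = a \<oplus> k \<otimes> k"
    using k smult_l_distr[of k 1 1] by (simp add: smult_one)
  have "k\<^sup>\<star> = k"
  proof (rule limit_unique[of K])
    show "(\<lambda>n. nrm A (K n \<ominus> k\<^sup>\<star>)) \<longlonglongrightarrow> 0"
    proof (rule squeeze)
      fix n
      show "nrm A (K n \<ominus> k\<^sup>\<star>) \<le> 1 * nrm A (K n \<ominus> k)"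
        using q_adj[of "K n \<ominus> k"] Kc[of n] k by (simp add: adj_diff Kadj clos)
    qed (simp add: Kc k clos)
  qed (simp_all add: Kc k clos lim)
  moreover have "k \<otimes> b = b \<otimes> k" if b: "b \<in> carrier A" "a \<otimes> b = b \<otimes> a" for b
  proof (rule limit_unique[of "\<lambda>n. K n \<otimes> b"])
    show "(\<lambda>n. nrm A (K n \<otimes> b \<ominus> k \<otimes> b)) \<longlonglongrightarrow> 0"
    proof (rule squeeze)
      fix n
      show "nrm A (K n \<otimes> b \<ominus> k \<otimes> b) \<le> nrm A b * nrm A (K n \<ominus> k)"
        using nrm_mult[of "K n \<ominus> k" b] Kc[of n] k b by (simp add: mult_diff_l clos mult.commute)
    qed (simp add: Kc k b clos)
    show "(\<lambda>n. nrm A (K n \<otimes> b \<ominus> b \<otimes> k)) \<longlonglongrightarrow> 0"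
    proof (rule squeeze)
      fix n
      show "nrm A (K n \<otimes> b \<ominus> b \<otimes> k) \<le> nrm A b * nrm A (K n \<ominus> k)"
        using nrm_mult[of b "K n \<ominus> k"] Kc[of n] k b by (simp add: mult_diff_r Kcomm clos)
    qed (simp add: Kc k b clos)
  qed (simp_all add: Kc k b clos)
  ultimately show ?thesis using that[OF k _ k2] by blast
qed

text \<open>
  Formally \<open>u = h + i sqrt (1 - h\<^sup>2)\<close> is unitary with real part \<open>h\<close>; the element \<open>z = u h\<close> and its
  properties \<open>z\<^sup>* z = h\<^sup>2\<close>, \<open>z + z\<^sup>* = 2 h\<^sup>2\<close> need no unit and only the C*-identity for \<open>q\<close>.
\<close>

lemma cstar_seminorm_le_1:
  assumes q: "cstar_seminorm A q" and h: "h \<in> carrier A" "h\<^sup>\<star> = h" "nrm A h < 1"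
  shows "q h \<le> 1"
proof -
  interpret Q: seminormed_star_algebra A q by unfold_locales (rule q)
  define p where "p = h \<otimes> h"
  have p: "p \<in> carrier A" "p\<^sup>\<star> = p" using h by (simp_all add: p_def clos adj_mult)
  have "nrm A p < 1"
    using nrm_cstar[OF h(1)] h q_nonneg[OF h(1)] by (simp add: p_def power_less_one_iff)
  moreover have "p \<otimes> h = h \<otimes> p" using h by (simp add: p_def mult_assoc)
  ultimately obtain k where k: "k \<in> carrier A" "k\<^sup>\<star> = k" "k \<oplus> k = p \<oplus> k \<otimes> k" "k \<otimes> h = h \<otimes> k"
    using one_minus_sqrt_exists[OF p] h(1) by metis
  \<comment> \<open>With \<open>k\<close> in the role of 1 - sqrt(1 - h^2), this is sqrt(1 - h^2)
    h.\<close>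
  define w where "w = h \<ominus> k \<otimes> h"
  have w: "w \<in> carrier A" using h k by (simp add: w_def clos)
  have w_adj: "w\<^sup>\<star> = w" using h k by (simp add: w_def adj_diff adj_mult clos)
  have "h \<otimes> (k \<otimes> h) = k \<otimes> p"
    using h(1) k(1,4) by (metis p_def mult_assoc)
  then have hw: "h \<otimes> w = p \<ominus> k \<otimes> p"
    using h(1) k(1) by (simp add: w_def mult_diff_r clos flip: p_def)
  have wh: "w \<otimes> h = p \<ominus> k \<otimes> p"
    using h(1) k(1) by (simp add: w_def p_def mult_diff_l clos mult_assoc)
  have pw: "p \<otimes> w = w \<otimes> p"
    using h w hw wh by (metis p_def mult_assoc)
  \<comment> \<open>Formally w^2 = (1 - k)^2 h^2 = (1 - h^2) h^2, expanded so that no unit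
    occurs.\<close>
  have "w \<otimes> w = (p \<ominus> k \<otimes> p) \<ominus> k \<otimes> (p \<ominus> k \<otimes> p)"
  proof -
    have "w \<otimes> w = h \<otimes> w \<ominus> k \<otimes> h \<otimes> w"
      using h k w by (subst (1) w_def) (simp add: mult_diff_l clos)
    then show ?thesis using h(1) k(1) w by (simp add: mult_assoc hw clos)
  qed
  also have "\<dots> = (p \<oplus> k \<otimes> (k \<otimes> p)) \<ominus> (k \<otimes> p \<oplus> k \<otimes> p)"
    using k(1) p(1) by (simp add: mult_diff_r clos) (simp add: a_minus_def minus_add clos a_ac)
  \<comment> \<open>The equation defining \<open>k\<close>, multiplied on the right by
    \<open>p\<close>.\<close>
  also have "k \<otimes> p \<oplus> k \<otimes> p = p \<otimes> p \<oplus> k \<otimes> (k \<otimes> p)"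
    using k(1,3) p(1) by (metis mult_assoc mult_closed mult_l_distr)
  also have "(p \<oplus> k \<otimes> (k \<otimes> p)) \<ominus> (p \<otimes> p \<oplus> k \<otimes> (k \<otimes> p)) = p \<ominus> p \<otimes> p"
    using k(1) p(1) by (simp add: add_diff_add diff_self clos)
  finally have ww: "w \<otimes> w = p \<ominus> p \<otimes> p" .
  have cancel: "\<i> \<odot> x \<oplus> (-\<i>) \<odot> x = \<zero>" if "x \<in> carrier A" for x
    using that by (simp add: zero_smult flip: smult_l_distr)
  define z where "z = p \<oplus> \<i> \<odot> w"
  have z: "z \<in> carrier A" using p w by (simp add: z_def clos)
  have z_adj: "z\<^sup>\<star> = p \<oplus> (-\<i>) \<odot> w"
    using p w by (simp add: z_def adj_add adj_smult w_adj clos)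
  \<comment> \<open>The cross terms cancel because \<open>p\<close> and \<open>w\<close> commute.
    What remains is p^2 + w^2 = p, so the C*-identity gives \<open>z\<close> and \<open>h\<close>
    the same seminorm.\<close>
  have "z\<^sup>\<star> \<otimes> z = (p \<otimes> p \<oplus> w \<otimes> w) \<oplus> (\<i> \<odot> (w \<otimes> p) \<oplus> (-\<i>) \<odot> (w \<otimes> p))"
    unfolding z_adj unfolding z_def using p(1) w
    by (simp add: mult_l_distr mult_r_distr smult_mult_l smult_mult_r clos pw a_ac smult_one smult_r_distr
        flip: smult_assoc)
  then have "z\<^sup>\<star> \<otimes> z = h\<^sup>\<star> \<otimes> h"
    using p(1) w h(2) by (simp add: cancel ww add_diff_cancel clos flip: p_def)
  then have "(q z)\<^sup>2 = (q h)\<^sup>2" using Q.q_cstar z h(1) by metis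
  then have qz: "q z = q h" using Q.q_nonneg z h(1) by simp
  have "z \<oplus> z\<^sup>\<star> = (p \<oplus> p) \<oplus> (\<i> \<odot> w \<oplus> (-\<i>) \<odot> w)"
    unfolding z_adj unfolding z_def using p(1) w by (simp add: clos a_ac)
  also have "\<dots> = 2 \<odot> p"
    using p(1) w smult_l_distr[of p 1 1] by (simp add: cancel clos smult_one)
  \<comment> \<open>The triangle inequality bounds the seminorm of
    \<open>z \<oplus> z\<^sup>\<star>\<close> by 2 \<open>q h\<close>. As \<open>q p\<close> is the
    square of \<open>q h\<close>, this forces \<open>q h \<le> 1\<close>.\<close>
  finally have "2 * q p \<le> 2 * q h"
    using Q.q_triangle[of z "z\<^sup>\<star>"] Q.q_smult[of p 2] Q.q_adj[of z] z p qz by (simp add: clos)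
  moreover have "q p = (q h)\<^sup>2" using Q.q_cstar[OF h(1)] h by (simp add: p_def)
  ultimately have "q h * q h \<le> 1 * q h" by (simp add: power2_eq_square)
  then show ?thesis using Q.q_nonneg[OF h(1)]
    by (metis mult_le_cancel_right order.trans linorder_not_le zero_le_one)
qed

text \<open>The C*-identity, valid for both \<open>q\<close> and the norm, reduces the claim to the
  self-adjoint element \<open>h\<close>. Dividing \<open>h\<close> by any \<open>c > nrm A h\<close>
  brings it into the open unit ball, where \<open>cstar_seminorm_le_1\<close> applies; then
  \<open>c\<close> decreases to \<open>nrm A h\<close>.\<close>

theorem cstar_seminorm_le_nrm:
  assumes q: "cstar_seminorm A q" and x: "x \<in> carrier A"
  shows "q x \<le> nrm A x"
proof -
  interpret Q: seminormed_star_algebra A q by unfold_locales (rule q)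
  define h where "h = x\<^sup>\<star> \<otimes> x"
  have h: "h \<in> carrier A" "h\<^sup>\<star> = h" using x by (simp_all add: h_def clos adj_mult adj_adj)
  have "q h \<le> c" if c: "nrm A h < c" for c
  proof -
    have "c > 0" using c q_nonneg[OF h(1)] by simp
    moreover have "q (complex_of_real (1 / c) \<odot> h) \<le> 1"
      using h c \<open>c > 0\<close> by (intro cstar_seminorm_le_1 q) (simp_all add: clos adj_smult nrm_smult norm_divide)
    ultimately show ?thesis using h by (simp add: Q.q_smult norm_divide)
  qed
  then have "q h \<le> nrm A h" by (rule dense_ge)
  then have "(q x)\<^sup>2 \<le> (nrm A x)\<^sup>2" using Q.q_cstar[OF x] nrm_cstar[OF x] by (simp add: h_def)
  then show ?thesis using power2_le_imp_le q_nonneg[OF x] by blast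
qed

end

section \<open>Contractivity, composition and inversion of *-homomorphisms\<close>

text \<open>The norm of \<open>B\<close> pulled back along \<open>f\<close> is a C*-seminorm on
  \<open>A\<close>, hence dominated by the norm of \<open>A\<close>.\<close>

corollary star_hom_contractive:
  assumes A: "cstar_algebra A" and B: "cstar_algebra B" and f: "f \<in> star_hom A B"
    and x: "x \<in> carrier A"
  shows "nrm B (f x) \<le> nrm A x"
proof -
  interpret A: cstar_algebra A by (rule A)
  interpret B: cstar_algebra B by (rule B)
  show ?thesis
    by (rule A.cstar_seminorm_le_nrm[OF star_hom_comp_seminorm[OF _ _ f B.seminorm] x])
       (rule A.star_algebra_axioms B.star_algebra_axioms)+
qed

lemma star_hom_compose:
  assumes f: "f \<in> star_hom A B" and g: "g \<in> star_hom B C" and A: "star_algebra A"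
  shows "compose (carrier A) g f \<in> star_hom A C"
proof -
  interpret A: star_algebra A by (rule A)
  show ?thesis
    using star_homD[OF f] star_homD[OF g] unfolding star_hom_def
    by (auto simp: compose_def A.clos)
qed

lemma restrict_id_star_hom:
  assumes "star_algebra A"
  shows "(\<lambda>x\<in>carrier A. x) \<in> star_hom A A"
proof -
  interpret A: star_algebra A by (rule assms)
  show ?thesis unfolding star_hom_def by (auto simp: A.clos)
qed

lemma star_iso_inverse:
  assumes A: "star_algebra A" and f: "f \<in> star_iso A B"
  shows "(\<lambda>y\<in>carrier B. inv_into (carrier A) f y) \<in> star_hom B A"
proof -
  interpret A: star_algebra A by (rule A)
  have fh: "f \<in> star_hom A B" and bij: "bij_betw f (carrier A) (carrier B)"
    using f by (simp_all add: star_iso_def)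
  note h = star_homD[OF fh]
  define g where "g = inv_into (carrier A) f"
  have gc: "g y \<in> carrier A" and fg: "f (g y) = y" if "y \<in> carrier B" for y
    using that bij by (simp_all add: g_def bij_betw_def inv_into_into f_inv_into_f)
  have gf: "g y = x" if "f x = y" "x \<in> carrier A" for x y
    using that bij by (auto simp: g_def bij_betw_def)
  \<comment> \<open>Each operation on \<open>carrier B\<close> is the \<open>f\<close>-image of the
    same operation on preimages. This gives closure of \<open>carrier B\<close> and, through
    \<open>gf\<close>, compatibility of \<open>g\<close>.\<close>
  have "g (x \<oplus>\<^bsub>B\<^esub> y) = g x \<oplus>\<^bsub>A\<^esub> g y" "g (x \<otimes>\<^bsub>B\<^esub> y) = g x \<otimes>\<^bsub>A\<^esub> g y"
    "g (c \<odot>\<^bsub>B\<^esub> x) = c \<odot>\<^bsub>A\<^esub> g x" "g (x\<^sup>\<star>\<^bsub>B\<^esub>) = (g x)\<^sup>\<star>\<^bsub>A\<^esub>"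
    "x \<oplus>\<^bsub>B\<^esub> y \<in> carrier B" "x \<otimes>\<^bsub>B\<^esub> y \<in> carrier B" "c \<odot>\<^bsub>B\<^esub> x \<in> carrier B" "x\<^sup>\<star>\<^bsub>B\<^esub> \<in> carrier B"
    if "x \<in> carrier B" "y \<in> carrier B" for x y c
    using h(1)[of "g x \<oplus>\<^bsub>A\<^esub> g y"] h(1)[of "g x \<otimes>\<^bsub>A\<^esub> g y"] h(1)[of "c \<odot>\<^bsub>A\<^esub> g x"] h(1)[of "(g x)\<^sup>\<star>\<^bsub>A\<^esub>"] that
    by (auto intro!: gf simp: h(2-5) gc fg A.clos)
  then show ?thesis unfolding star_hom_def g_def[symmetric] by (auto simp: gc)
qed

section \<open>Extending homomorphisms from the Leavitt path algebra to the graph C*-algebra\<close>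

context countable_graph
begin

text \<open>All but two kinds of relators are Leavitt relators, up to splitting \<open>CK1\<close>
  into its two cases. With s, s* for the edge and its ghost and r, p for its range and source
  vertices, the other two are s s* s - s = s(s* s - r) + (s r - s) and p s s* - s s* = (p s - s)
  s*.\<close>

lemma cuntz_krieger_relators_leavitt_ideal:
  assumes "r \<in> cuntz_krieger_relators E"
  shows "r \<in> LI"
proof -
  note gen = leavitt_relators.intros[THEN ideal_gen.gen]
  note ideal = L.ideal_add[unfolded free_simps] L.ideal_l_mult[unfolded free_simps(2)]
    L.ideal_r_mult[unfolded free_simps(2)]
  show ?thesis
    using assms
  proof cases
    case (partial_isometry e)
    have "ed e * (gh e * ed e - vx (head E e)) + (ed e * vx (head E e) - ed e) \<in> LI"
      using partial_isometry gen(4)[of e E] gen(7)[of e E e] by (intro ideal) (auto intro: FE_closed)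
    then show ?thesis unfolding partial_isometry(1) by (simp add: algebra_simps)
  next
    case (range_le e)
    have "(vx (tail E e) * ed e - ed e) * gh e \<in> LI"
      using range_le gen(3)[of e E] by (intro ideal) (auto intro: FE_closed)
    then show ?thesis unfolding range_le(1) by (simp add: algebra_simps)
  next
    case (orthogonal_ranges e f)
    then show ?thesis using gen(7)[of e E f] by simp
  next
    case (initial_projection e)
    then show ?thesis using gen(7)[of e E e] by simp
  qed (auto intro: gen)
qed

text \<open>The target is an arbitrary C*-algebra, so that the same result yields both the extension
  of \<phi> and that of its inverse.\<close>

lemma leavitt_hom_extends:
  assumes B: "cstar_algebra B" and f: "f \<in> star_hom (leavitt_path_algebra E) B"
  shows "\<exists>\<psi>\<in>star_hom (graph_cstar E) B.
    \<forall>x\<in>carrier (leavitt_path_algebra E). \<psi> (leavitt_to_cstar E x) = f x"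
proof -
  interpret B: cstar_algebra B by (rule B)
  \<comment> \<open>\<open>f\<close> is lifted to the free algebra, because
    \<open>graph_cstar E\<close> is a completion of that algebra.\<close>
  define \<pi> where "\<pi> = (\<lambda>x\<in>carrier FE. f (coset FE LI x))"
  note h = star_homD[OF f, unfolded leavitt_path_algebra_def]
  have \<pi>: "\<pi> \<in> star_hom FE B"
    unfolding star_hom_def \<pi>_def
    by (auto simp: F.clos L.quotient_carrier h simp flip: L.quotient_add L.quotient_mult
        L.quotient_smult L.quotient_adj)
  have "f (coset FE LI \<zero>\<^bsub>FE\<^esub>) = \<zero>\<^bsub>B\<^esub>"
    using h(2)[of "coset FE LI \<zero>\<^bsub>FE\<^esub>" "coset FE LI \<zero>\<^bsub>FE\<^esub>"] h(1)[of "coset FE LI \<zero>\<^bsub>FE\<^esub>"]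
    by (intro B.add_eq_selfD) (simp_all add: L.quotient_carrier L.quotient_add)
  then have rel: "nrm B (\<pi> r) = 0" if "r \<in> cuntz_krieger_relators E" for r
    using L.coset_eqI[of r "\<zero>\<^bsub>FE\<^esub>"] cuntz_krieger_relators_leavitt_ideal[OF that]
      cuntz_krieger_relators_carrier[OF that] by (simp add: \<pi>_def F.diff_zero B.q_zero)
  \<comment> \<open>The left-hand side is one of the seminorms in the supremum defining
    \<open>\<nu>\<close>.\<close>
  have "nrm B (\<pi> x) \<le> \<nu> x" if "x \<in> carrier FE" for x
    using that
    by (intro \<nu>_upper[where q = "\<lambda>x. nrm B (\<pi> x)"] star_hom_comp_seminorm[OF _ _ \<pi>]
        B.seminorm F.star_algebra_axioms B.star_algebra_axioms) (simp_all add: rel)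
  then obtain \<psi> where "\<psi> \<in> star_hom (graph_cstar E) B" "\<And>x. x \<in> carrier FE \<Longrightarrow> \<psi> (emb x) = \<pi> x"
    using completion_extend[OF K.seminormed_star_algebra_axioms B \<pi>] unfolding graph_cstar_def by blast
  then show ?thesis
    by (intro bexI[of _ \<psi>])
       (auto simp: leavitt_path_algebra_def L.quotient_carrier leavitt_to_cstar_coset \<pi>_def)
qed

text \<open>Both maps are contractive, and the image of the Leavitt path algebra is dense: an
  approximant within \<open>e / 2\<close> of \<open>x\<close> puts the two values within
  \<open>e\<close> of each other.\<close>

lemma graph_cstar_hom_eqI:
  assumes B: "cstar_algebra B"
    and f: "f \<in> star_hom (graph_cstar E) B" and g: "g \<in> star_hom (graph_cstar E) B"
    and eq: "\<And>x. x \<in> carrier (leavitt_path_algebra E) \<Longrightarrow>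
      f (leavitt_to_cstar E x) = g (leavitt_to_cstar E x)"
  shows "f = g"
proof (rule PiE_ext)
  show "f \<in> carrier (graph_cstar E) \<rightarrow>\<^sub>E carrier B" "g \<in> carrier (graph_cstar E) \<rightarrow>\<^sub>E carrier B"
    using f g by (simp_all add: star_hom_def)
  interpret A: cstar_algebra "graph_cstar E" by (rule cstar_algebra_graph_cstar)
  interpret B: cstar_algebra B by (rule B)
  fix x assume x: "x \<in> carrier (graph_cstar E)"
  have "nrm B (f x \<ominus>\<^bsub>B\<^esub> g x) \<le> 0 + e" if e: "e > 0" for e
  proof -
    obtain a where a: "a \<in> carrier (leavitt_path_algebra E)"
      "nrm (graph_cstar E) (x \<ominus>\<^bsub>graph_cstar E\<^esub> leavitt_to_cstar E a) < e / 2"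
      using leavitt_to_cstar_dense[OF x half_gt_zero[OF e]] by blast
    define y where "y = leavitt_to_cstar E a"
    have y: "y \<in> carrier (graph_cstar E)"
      unfolding y_def by (rule star_homD(1)[OF leavitt_to_cstar_star_hom a(1)])
    have "nrm B (k x \<ominus>\<^bsub>B\<^esub> k y) < e / 2" if "k \<in> star_hom (graph_cstar E) B" for k
      using star_hom_contractive[OF A.cstar_algebra_axioms B that A.minus_closed[OF x y]]
        star_hom_diff[OF A.star_algebra_axioms B.star_algebra_axioms that x y] a(2)
      by (simp add: y_def)
    from this[OF f] this[OF g] show ?thesis
      using B.q_diff_triangle[of "f x" "f y" "g x"] B.q_diff_commute[of "f y" "g x"] eq[OF a(1)]
        star_homD(1)[OF f] star_homD(1)[OF g] x y by (simp add: y_def)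
  qed
  then have "nrm B (f x \<ominus>\<^bsub>B\<^esub> g x) \<le> 0" by (rule field_le_epsilon)
  then have "nrm B (f x \<ominus>\<^bsub>B\<^esub> g x) = 0"
    using B.q_nonneg[of "f x \<ominus>\<^bsub>B\<^esub> g x"] star_homD(1)[OF f x] star_homD(1)[OF g x] by simp
  then show "f x = g x"
    using B.nrm_eq_0 B.diff_eq_zeroD B.minus_closed star_homD(1)[OF f x] star_homD(1)[OF g x] by metis
qed

text \<open>Serves to recognise the composites of mutually inverse extensions. The comparison is
  with the identity restricted to the carrier, which is extensional.\<close>

lemma graph_cstar_endo_eq_id:
  assumes f: "f \<in> star_hom (graph_cstar E) (graph_cstar E)"
    and eq: "\<And>x. x \<in> carrier (leavitt_path_algebra E) \<Longrightarrow>
      f (leavitt_to_cstar E x) = leavitt_to_cstar E x"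
    and x: "x \<in> carrier (graph_cstar E)"
  shows "f x = x"
proof -
  interpret A: cstar_algebra "graph_cstar E" by (rule cstar_algebra_graph_cstar)
  have "f = (\<lambda>x\<in>carrier (graph_cstar E). x)"
    using star_homD(1)[OF leavitt_to_cstar_star_hom]
    by (intro graph_cstar_hom_eqI[OF A.cstar_algebra_axioms f] restrict_id_star_hom A.star_algebra_axioms)
       (simp add: eq)
  then show ?thesis using x by simp
qed

end

section \<open>The induced homomorphism and its inverse\<close>

theorem theorem4p4:
  fixes E :: "('v, 'e) pre_digraph"
    and F :: "('w, 'f) pre_digraph"
    and \<phi> :: "('v, 'e) free_alg set \<Rightarrow> ('w, 'f) free_alg set"
  assumes "countable_graph E" and "countable_graph F"
    and "\<phi> \<in> star_hom (leavitt_path_algebra E) (leavitt_path_algebra F)"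
  shows "(\<exists>!\<psi>. \<psi> \<in> star_hom (graph_cstar E) (graph_cstar F) \<and>
            (\<forall>x\<in>carrier (leavitt_path_algebra E).
               \<psi> (leavitt_to_cstar E x) = leavitt_to_cstar F (\<phi> x))) \<and>
         (\<phi> \<in> star_iso (leavitt_path_algebra E) (leavitt_path_algebra F) \<longrightarrow>
            (\<forall>\<psi>. \<psi> \<in> star_hom (graph_cstar E) (graph_cstar F) \<and>
               (\<forall>x\<in>carrier (leavitt_path_algebra E).
                  \<psi> (leavitt_to_cstar E x) = leavitt_to_cstar F (\<phi> x)) \<longrightarrow>
               \<psi> \<in> star_iso (graph_cstar E) (graph_cstar F)))"
proof (intro conjI impI allI, goal_cases)
  interpret E: countable_graph E by (rule assms(1))
  interpret F: countable_graph F by (rule assms(2))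
  note cE = E.cstar_algebra_graph_cstar and cF = F.cstar_algebra_graph_cstar
  note lE = E.star_algebra_leavitt_path_algebra and lF = F.star_algebra_leavitt_path_algebra
  {
    case 1
    obtain \<psi> where "\<psi> \<in> star_hom (graph_cstar E) (graph_cstar F)"
      "\<forall>x\<in>carrier (leavitt_path_algebra E). \<psi> (leavitt_to_cstar E x) = leavitt_to_cstar F (\<phi> x)"
      using E.leavitt_hom_extends[OF cF star_hom_compose[OF assms(3) F.leavitt_to_cstar_star_hom lE]]
      by (auto simp: compose_def)
    then show ?case
      by (intro ex_ex1I) (auto intro: E.graph_cstar_hom_eqI[OF cF])
  next
    case (2 \<psi>)
    note iso = 2(1) and \<psi> = 2(2)[THEN conjunct1]
    define \<theta> where "\<theta> = (\<lambda>y\<in>carrier (leavitt_path_algebra F). inv_into (carrier (leavitt_path_algebra E)) \<phi> y)"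
    have \<theta>: "\<theta> \<in> star_hom (leavitt_path_algebra F) (leavitt_path_algebra E)"
      unfolding \<theta>_def by (rule star_iso_inverse[OF lE iso])
    have bij: "bij_betw \<phi> (carrier (leavitt_path_algebra E)) (carrier (leavitt_path_algebra F))"
      using iso by (simp add: star_iso_def)
    have inv: "x \<in> carrier (leavitt_path_algebra E) \<Longrightarrow> \<theta> (\<phi> x) = x"
      "y \<in> carrier (leavitt_path_algebra F) \<Longrightarrow> \<phi> (\<theta> y) = y" for x y
      using bij by (auto simp: \<theta>_def bij_betw_def f_inv_into_f)
    \<comment> \<open>\<open>\<chi>\<close> extends the composite of \<open>\<theta>\<close> with
      the canonical map of \<open>E\<close>. Since \<open>\<theta>\<close> inverts \<phi>, both
      composites of \<open>\<chi>\<close> and \<open>\<psi>\<close> fix the images of the canonical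
      maps.\<close>
    obtain \<chi> where \<chi>: "\<chi> \<in> star_hom (graph_cstar F) (graph_cstar E)"
      "\<And>y. y \<in> carrier (leavitt_path_algebra F) \<Longrightarrow> \<chi> (leavitt_to_cstar F y) = leavitt_to_cstar E (\<theta> y)"
      using F.leavitt_hom_extends[OF cE star_hom_compose[OF \<theta> E.leavitt_to_cstar_star_hom lF]]
      by (auto simp: compose_def)
    have sE: "star_algebra (graph_cstar E)" and sF: "star_algebra (graph_cstar F)"
      using cE cF by (simp_all add: cstar_algebra_def)
    note ceE = star_homD(1)[OF E.leavitt_to_cstar_star_hom] and ceF = star_homD(1)[OF F.leavitt_to_cstar_star_hom]
    have "\<chi> (\<psi> x) = x" if "x \<in> carrier (graph_cstar E)" for x
      using E.graph_cstar_endo_eq_id[OF star_hom_compose[OF \<psi> \<chi>(1) sE] _ that] that 2(2)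
        \<chi>(2) inv(1) ceE star_homD(1)[OF assms(3)] by (simp add: compose_def)
    moreover have "\<psi> (\<chi> y) = y" if "y \<in> carrier (graph_cstar F)" for y
      using F.graph_cstar_endo_eq_id[OF star_hom_compose[OF \<chi>(1) \<psi> sF] _ that] that 2(2)
        \<chi>(2) inv(2) ceF star_homD(1)[OF \<theta>] by (simp add: compose_def)
    ultimately have "bij_betw \<psi> (carrier (graph_cstar E)) (carrier (graph_cstar F))"
      using star_homD(1)[OF \<psi>] star_homD(1)[OF \<chi>(1)]
      by (intro bij_betw_byWitness[where f' = \<chi>]) auto
    then show ?case using \<psi> by (simp add: star_iso_def)
  }
qed

end
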